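(* Let $\lambda=(\lambda_n)$ be a frequency which satisfies $(LC)$, or satisfies $L(\lambda)=0$, or is $\mathbf{Q}$-linearly independent. Let $(D_j)_{j\in\mathbf{N}}\subset\mathcal{D}_\infty(\lambda)$ be a bounded sequence (i.e. $\sup_j\|D_j\|_\infty<\infty$), $D_j=\sum a_n^j e^{-\lambda_n s}$. Then there is a subsequence $(j_k)$ such that the limits $a_n:=\lim_{k\to\infty}a_n^{j_k}$ exist for all $n$, the series $D:=\sum a_n e^{-\lambda_n s}$ belongs to $\mathcal{D}_\infty(\lambda)$, and $(D_{j_k})$ converges to $D$ uniformly on $[Re>\varepsilon]$ for all $\varepsilon>0$.
   Context: A frequency is a strictly increasing sequence $\lambda=(\lambda_n)_{n\in\mathbf{N}}$ of non-negative real numbers tending to $+\infty$ ($\mathbf{N}=\{1,2,\dots\}$). A $\lambda$-Dirichlet series is a formal sum $D=\sum_{n\ge 1} a_n e^{-\lambda_n s}$ with complex coefficients $a_n$ and complex variable $s$. $[Re>\sigma]=\{s\in\mathbf{C}: \mathrm{Re}\,s>\sigma\}$. $\mathcal{D}_\infty(\lambda)$ is the space of all $\lambda$-Dirichlet series $D$ which converge on $[Re>0]$ and define a bounded function there, with norm $\|D\|_\infty:=\sup_{[Re>0]}|D(s)|$. Landau's condition $(LC)$: for every $\delta>0$ there is $C>0$ such that for all $n\in\mathbf{N}$, $\lambda_{n+1}-\lambda_n\ge C e^{-e^{\delta\lambda_n}}$. $L(\lambda):=\limsup_{N\to\infty}\frac{\log N}{\lambda_N}$. $\lambda$ is $\mathbf{Q}$-linearly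 independent if $\sum q_n\lambda_n=0$ implies $q=0$ for all finite rational sequences $q=(q_n)$. *)

theory Defs
  imports "HOL-Analysis.Analysis"
begin

text \<open>
  All sequences are indexed from 0, so that \<open>l n\<close> and \<open>a n\<close> stand for the
  mathematical $\lambda_{n+1}$ and $a_{n+1}$. A formal Dirichlet series over a fixed
  frequency \<open>l\<close> is represented by its coefficient sequence.
\<close>

definition frequency :: "(nat \<Rightarrow> real) \<Rightarrow> bool" where
  "frequency l \<longleftrightarrow> strict_mono l \<and> (\<forall>n. 0 \<le> l n) \<and> filterlim l at_top sequentially"

definition landau_condition :: "(nat \<Rightarrow> real) \<Rightarrow> bool" where
  "landau_condition l \<longleftrightarrow>
     (\<forall>\<delta>>0. \<exists>C>0. \<forall>n. l (Suc n) - l n \<ge> C * exp (- exp (\<delta> * l n)))"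

text \<open>Because of the index shift, the numerator belonging to \<open>l n\<close> is $\log (n+1)$.\<close>

definition freq_L :: "(nat \<Rightarrow> real) \<Rightarrow> ereal" where
  "freq_L l = limsup (\<lambda>n. ereal (ln (real (Suc n)) / l n))"

definition rat_independent :: "(nat \<Rightarrow> real) \<Rightarrow> bool" where
  "rat_independent l \<longleftrightarrow>
     (\<forall>N (q :: nat \<Rightarrow> rat). (\<Sum>n<N. of_rat (q n) * l n) = 0 \<longrightarrow> (\<forall>n<N. q n = 0))"

definition dirichlet_term :: "(nat \<Rightarrow> real) \<Rightarrow> (nat \<Rightarrow> complex) \<Rightarrow> complex \<Rightarrow> nat \<Rightarrow> complex" where
  "dirichlet_term l a s n = a n * exp (- (complex_of_real (l n) * s))"

definition dirichlet_sum :: "(nat \<Rightarrow> real) \<Rightarrow> (nat \<Rightarrow> complex) \<Rightarrow> complex \<Rightarrow> complex" where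
  "dirichlet_sum l a s = (\<Sum>n. dirichlet_term l a s n)"

definition D_infty :: "(nat \<Rightarrow> real) \<Rightarrow> (nat \<Rightarrow> complex) set" where
  "D_infty l = {a. (\<forall>s. Re s > 0 \<longrightarrow> summable (dirichlet_term l a s)) \<and>
                   bounded (dirichlet_sum l a ` {s. Re s > 0})}"

text \<open>This real supremum is meaningful only for \<open>a \<in> D_infty l\<close>.\<close>

definition norm_infty :: "(nat \<Rightarrow> real) \<Rightarrow> (nat \<Rightarrow> complex) \<Rightarrow> real" where
  "norm_infty l a = (SUP s\<in>{s. Re s > 0}. norm (dirichlet_sum l a s))"

end

(*
  The key is a bound of the form  |sum_{n<=k} a_n e^{-l_n s}| <= B e^{d l_k}  on [Re > 0], for every
  d > 0, with B depending only on d, l and a bound for the norms. Abel summation turns it into uniform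
  smallness of the tails on [Re > 2d], and a diagonal subsequence of the (bounded) coefficients does the rest.

  For the key bound, D(s + it) is integrated against K(t) = (cos ct - cos dt) sin(ht) / t^3. Up to a
  constant factor, the Fourier transform of K is 1 on [-(c-h), c-h] and 0 off [-(d+h), d+h], and the
  corresponding L^1 norm of K is O(1 + log((d+c)/(d-c))). Thus smoothed partial sums of D are bounded by a multiple
  of its norm. Under (LC) the transition is put into the gap between l_k and l_(k+1), so that the
  partial sum itself appears and the logarithm is O(e^{d l_k}). If L(l) = 0, a modulated kernel isolates
  a single a_n. For Q-independent l, Kronecker's theorem upgrades the bound of a smoothed sum to
  one for the sum of the moduli of its terms.
*)
theory Submission
  imports Defs "HOL-Complex_Analysis.Great_Picard" "HOL-Real_Asymp.Real_Asymp"
begin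

section \<open>A smoothing kernel with compactly supported Fourier transform\<close>

lemma has_bochner_integral_two_scale:
  fixes p q :: real
  assumes "0 < p" "p < q"
  shows "has_bochner_integral lborel (\<lambda>t. p * q / ((1 + p * \<bar>t\<bar>) * (1 + q * \<bar>t\<bar>)))
           (2 * (p * q / (q - p) * ln (q / p)))"
proof -
  define f where "f t = p * q / ((1 + p * \<bar>t\<bar>) * (1 + q * \<bar>t\<bar>))" for t
  \<comment> \<open>Partial fractions give this antiderivative of \<open>f\<close> for t >= 0; at
    infinity the two logarithms combine into ln (q / p). Evenness doubles the integral at the
    end.\<close>
  define F where "F t = p * q / (q - p) * (ln (1 + q * t) - ln (1 + p * t))" for t
  have [measurable]: "f \<in> borel_measurable borel"
    unfolding f_def by measurable
  have nonneg: "0 \<le> f t" for t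
    using assms by (simp add: f_def)
  have "(\<integral>\<^sup>+t. ennreal (f t) * indicator {0..} t \<partial>lborel)
      = ennreal (p * q / (q - p) * ln (q / p) - F 0)"
  proof (rule nn_integral_FTC_atLeast)
    fix t :: real assume t: "0 \<le> t"
    have pos: "0 < 1 + p * t" "0 < 1 + q * t"
      using t assms by (simp_all add: add_pos_nonneg)
    have "(F has_real_derivative p * q / (q - p) * (q / (1 + q * t) - p / (1 + p * t))) (at t)"
      unfolding F_def using pos assms by (auto intro!: derivative_eq_intros)
    moreover have "q / (1 + q * t) - p / (1 + p * t) = (q - p) / ((1 + p * t) * (1 + q * t))"
      using pos by (simp add: divide_simps) (simp add: algebra_simps)
    then have "p * q / (q - p) * (q / (1 + q * t) - p / (1 + p * t)) = f t"
      using assms t by (simp add: f_def)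
    ultimately show "(F has_real_derivative f t) (at t)" by simp
  next
    show "(F \<longlongrightarrow> p * q / (q - p) * ln (q / p)) at_top"
    proof -
      have "(F \<longlongrightarrow> p * q * (ln q - ln p) / (q - p)) at_top"
        unfolding F_def using assms by real_asymp
      then show ?thesis using assms by (simp add: ln_div)
    qed
  qed (auto simp: nonneg)
  then have "has_bochner_integral lborel (\<lambda>t. indicator {0..} t *\<^sub>R f t) (p * q / (q - p) * ln (q / p))"
    using assms nonneg
    by (intro has_bochner_integral_nn_integral)
      (auto simp: F_def ennreal_mult'[symmetric] ennreal_indicator[symmetric] mult.commute)
  from has_bochner_integral_even_function[OF this] show ?thesis
    by (simp add: f_def)
qed

lemma integrable_two_scale_1_2: "integrable lborel (\<lambda>t::real. 1 / ((1 + \<bar>t\<bar>) * (1 + 2 * \<bar>t\<bar>)))"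
  using has_bochner_integral_two_scale[of 1 2] unfolding has_bochner_integral_iff
  by (auto dest: integrable_divide[of _ _ 2])

section \<open>The model integral of (t - sin t) / t^3\<close>

definition sin_cubic :: "real \<Rightarrow> real" where
  "sin_cubic t = (t - sin t) / t ^ 3"

lemma sin_cubic_nonneg: "0 \<le> sin_cubic t"
proof (cases "t \<ge> 0")
  case True
  then show ?thesis using sin_x_le_x by (simp add: sin_cubic_def)
next
  case False
  then have "t - sin t \<le> 0" "t ^ 3 \<le> 0"
    using sin_x_le_x[of "- t"] by (auto simp: power_le_zero_eq)
  then show ?thesis by (simp add: sin_cubic_def divide_nonpos_nonpos)
qed

lemma borel_measurable_sin_cubic [measurable]: "sin_cubic \<in> borel_measurable borel"
  unfolding sin_cubic_def by measurable

text \<open>The numerator vanishes to third order at 0, and far out the quotient is at most 2 / t^2.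
  The constant is 12 = 2 * 6, since the denominator on the right is at most 6 * t^2 for |t| >
  1.\<close>

lemma abs_sin_cubic_le: "\<bar>sin_cubic t\<bar> \<le> 12 * (1 / ((1 + \<bar>t\<bar>) * (1 + 2 * \<bar>t\<bar>)))"
proof (cases "t = 0")
  case True
  then show ?thesis by (simp add: sin_cubic_def)
next
  case False
  have pos: "0 < (1 + \<bar>t\<bar>) * (1 + 2 * \<bar>t\<bar>)" by (simp add: add_pos_nonneg)
  show ?thesis
  proof (cases "\<bar>t\<bar> \<le> 1")
    case True
    have "\<bar>sin t - (\<Sum>m<3. sin_coeff m * t ^ m)\<bar> \<le> inverse (fact 3) * \<bar>t\<bar> ^ 3"
      by (rule Maclaurin_sin_bound)
    then have "6 * \<bar>t - sin t\<bar> \<le> \<bar>t\<bar> ^ 3"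
      by (simp add: sin_coeff_def numeral_3_eq_3 abs_minus_commute fact_numeral)
    then have "\<bar>t - sin t\<bar> \<le> \<bar>t\<bar> ^ 3"
      by (rule order_trans[rotated]) simp
    then have 1: "\<bar>sin_cubic t\<bar> \<le> 1"
      using False by (simp add: sin_cubic_def divide_simps power_abs)
    have "(1 + \<bar>t\<bar>) * (1 + 2 * \<bar>t\<bar>) \<le> 2 * 3"
      using True by (intro mult_mono) auto
    then have "1 \<le> 12 * (1 / ((1 + \<bar>t\<bar>) * (1 + 2 * \<bar>t\<bar>)))"
      using pos by (simp add: divide_simps)
    with 1 show ?thesis by linarith
  next
    case large: False
    have "\<bar>t - sin t\<bar> \<le> 2 * \<bar>t\<bar>"
      using abs_sin_x_le_abs_x[of t] by linarith
    then have "\<bar>sin_cubic t\<bar> \<le> 2 * \<bar>t\<bar> / \<bar>t\<bar> ^ 3"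
      by (simp add: sin_cubic_def power_abs divide_right_mono)
    also have "\<dots> = 2 / t\<^sup>2"
      using False by (simp add: divide_simps power2_eq_square power3_eq_cube)
    also have "\<dots> \<le> 12 * (1 / ((1 + \<bar>t\<bar>) * (1 + 2 * \<bar>t\<bar>)))"
    proof -
      have "(1 + \<bar>t\<bar>) * (1 + 2 * \<bar>t\<bar>) \<le> (2 * \<bar>t\<bar>) * (3 * \<bar>t\<bar>)"
        using large by (intro mult_mono) auto
      also have "\<dots> = 6 * t\<^sup>2" by (simp add: power2_eq_square)
      finally show ?thesis using pos False by (simp add: divide_simps)
    qed
    finally show ?thesis .
  qed
qed

lemma integrable_sin_cubic: "integrable lborel sin_cubic"
  by (rule Bochner_Integration.integrable_bound[OF integrable_mult_right[OF integrable_two_scale_1_2, of 12]])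
    (use abs_sin_cubic_le in auto)

definition sin_cubic_mass :: real where
  "sin_cubic_mass = (\<integral>t. sin_cubic t \<partial>lborel)"

text \<open>This number normalises the kernel and will be divided by. On the interval (1, 2) the
  integrand is positive because sin t <= 1 < t.\<close>

lemma sin_cubic_mass_pos: "0 < sin_cubic_mass"
proof -
  have "sin_cubic_mass \<noteq> 0"
  proof
    assume "sin_cubic_mass = 0"
    then have "AE t in lborel. sin_cubic t = 0"
      using integral_nonneg_eq_0_iff_AE[OF integrable_sin_cubic] sin_cubic_nonneg
      by (simp add: sin_cubic_mass_def)
    then have "AE t in lborel. t \<notin> {1<..<2::real}"
    proof eventually_elim
      case (elim t)
      show ?case
        using elim sin_le_one[of t] by (auto simp: sin_cubic_def simp del: sin_le_one)
    qed
    then have "emeasure lborel {1<..<2::real} = 0"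
      using AE_iff_null[of lborel "\<lambda>t. t \<notin> {1<..<2::real}"]
      by (simp add: null_sets_def greaterThanLessThan_def greaterThan_def lessThan_def Int_def)
    then show False by simp
  qed
  moreover have "0 \<le> sin_cubic_mass"
    unfolding sin_cubic_mass_def by (rule Bochner_Integration.integral_nonneg) (rule sin_cubic_nonneg)
  ultimately show ?thesis by simp
qed

text \<open>Scaling gives the integral up to the value of \<open>sin_cubic_mass\<close>, which is never needed.\<close>

lemma has_bochner_integral_sin_cubic_scaled:
  "has_bochner_integral lborel (\<lambda>t. (x * t - sin (x * t)) / t ^ 3) (sin_cubic_mass * (x * \<bar>x\<bar>))"
proof (cases "x = 0")
  case True
  then show ?thesis by (simp add: has_bochner_integral_zero)
next
  case False
  have "has_bochner_integral lborel sin_cubic sin_cubic_mass"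
    using integrable_sin_cubic by (simp add: has_bochner_integral_iff sin_cubic_mass_def)
  then have "has_bochner_integral lborel (\<lambda>t. sin_cubic (0 + x * t)) (sin_cubic_mass /\<^sub>R \<bar>x\<bar>)"
    by (rule lborel_has_bochner_integral_real_affine_iff[OF False, THEN iffD1])
  \<comment> \<open>The cube restores the denominator t^3; with the Jacobian 1 / |x| it leaves x^3 /
    |x| = x * |x|, a square that keeps the sign of x.\<close>
  then have "has_bochner_integral lborel (\<lambda>t. x ^ 3 * sin_cubic (0 + x * t))
      (x ^ 3 * (sin_cubic_mass /\<^sub>R \<bar>x\<bar>))"
    by (rule has_bochner_integral_mult_right)
  moreover have "x ^ 3 * (sin_cubic_mass /\<^sub>R \<bar>x\<bar>) = sin_cubic_mass * (x * \<bar>x\<bar>)"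
    using False by (cases "x > 0") (simp_all add: power3_eq_cube divide_simps)
  moreover have "x ^ 3 * sin_cubic (0 + x * t) = (x * t - sin (x * t)) / t ^ 3" for t
    using False by (simp add: sin_cubic_def power_mult_distrib)
  ultimately show ?thesis by (simp only: add_0)
qed

section \<open>The kernel and its L^1 norm\<close>

lemma abs_sin_le_ratio: "\<bar>sin x\<bar> \<le> 3 * \<bar>x\<bar> / (1 + 2 * \<bar>x\<bar>)" for x :: real
proof (cases "\<bar>x\<bar> \<le> 1")
  case True
  then have "\<bar>x\<bar> * \<bar>x\<bar> \<le> \<bar>x\<bar> * 1" by (intro mult_left_mono) auto
  then have "\<bar>x\<bar> \<le> 3 * \<bar>x\<bar> / (1 + 2 * \<bar>x\<bar>)"
    by (simp add: pos_le_divide_eq add_pos_nonneg algebra_simps)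
  with abs_sin_x_le_abs_x[of x] show ?thesis by linarith
next
  case False
  then have "1 \<le> 3 * \<bar>x\<bar> / (1 + 2 * \<bar>x\<bar>)"
    by (simp add: pos_le_divide_eq add_pos_nonneg)
  with abs_sin_le_one[of x] show ?thesis by linarith
qed

text \<open>The transform of (cos (a t) - cos (b t)) / t^2 is a trapezoid, constant on [-a, a] and
  supported in [-b, b]. The factor sin (h t) / t convolves it with the indicator of [-h, h]: the
  plateau shrinks by h, the support grows by h, and the kernel gains one power of decay.\<close>

definition kernel :: "real \<Rightarrow> real \<Rightarrow> real \<Rightarrow> real \<Rightarrow> real" where
  "kernel a b h t = (cos (a * t) - cos (b * t)) * sin (h * t) / t ^ 3"

lemma borel_measurable_kernel [measurable]: "kernel a b h \<in> borel_measurable borel"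
  unfolding kernel_def by measurable

text \<open>The difference of cosines is a product of sines at the scales (b - a) / 2 and (b + a) /
  2, and each sine is bounded by a rational substitute for min 1 |x|. The third sine is kept,
  because it is estimated by its decay for integrability and by h for the L^1 norm.\<close>

lemma abs_kernel_le:
  assumes "0 < a" "a < b" "0 < h"
  shows "\<bar>kernel a b h t\<bar> \<le>
    9 / 2 * ((b - a) * (b + a) / ((1 + (b - a) * \<bar>t\<bar>) * (1 + (b + a) * \<bar>t\<bar>))) * (\<bar>sin (h * t)\<bar> / \<bar>t\<bar>)"
proof (cases "t = 0")
  case True
  then show ?thesis by (simp add: kernel_def)
next
  case False
  have *: "\<bar>sin (c * t / 2)\<bar> \<le> 3 / 2 * (c / (1 + c * \<bar>t\<bar>)) * \<bar>t\<bar>" if "0 < c" for c :: real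
    using abs_sin_le_ratio[of "c * t / 2"] that by (simp add: abs_mult mult_ac)
  have "cos (a * t) - cos (b * t) = 2 * sin ((b + a) * t / 2) * sin ((b - a) * t / 2)"
    unfolding cos_diff_cos by (simp add: algebra_simps)
  then have "\<bar>cos (a * t) - cos (b * t)\<bar> = 2 * (\<bar>sin ((b + a) * t / 2)\<bar> * \<bar>sin ((b - a) * t / 2)\<bar>)"
    by (simp add: abs_mult)
  also have "\<dots> \<le> 2 * ((3 / 2 * ((b + a) / (1 + (b + a) * \<bar>t\<bar>)) * \<bar>t\<bar>) * (3 / 2 * ((b - a) / (1 + (b - a) * \<bar>t\<bar>)) * \<bar>t\<bar>))"
    using assms by (intro mult_left_mono mult_mono * mult_nonneg_nonneg divide_nonneg_nonneg add_nonneg_nonneg) auto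
  also have "\<dots> = 9 / 2 * ((b - a) * (b + a) / ((1 + (b - a) * \<bar>t\<bar>) * (1 + (b + a) * \<bar>t\<bar>))) * \<bar>t\<bar>\<^sup>2"
  proof -
    have "2 * ((3 / 2 * y * u) * (3 / 2 * x * u)) = 9 / 2 * (x * y) * u\<^sup>2" for x y u :: real
      by (simp add: power2_eq_square)
    then show ?thesis by (simp only: times_divide_times_eq[symmetric])
  qed
  finally have "\<bar>cos (a * t) - cos (b * t)\<bar> * (\<bar>sin (h * t)\<bar> / \<bar>t\<bar> ^ 3) \<le>
      9 / 2 * ((b - a) * (b + a) / ((1 + (b - a) * \<bar>t\<bar>) * (1 + (b + a) * \<bar>t\<bar>))) * \<bar>t\<bar>\<^sup>2 * (\<bar>sin (h * t)\<bar> / \<bar>t\<bar> ^ 3)"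
    by (rule mult_right_mono) simp
  also have "\<dots> = 9 / 2 * ((b - a) * (b + a) / ((1 + (b - a) * \<bar>t\<bar>) * (1 + (b + a) * \<bar>t\<bar>))) * (\<bar>sin (h * t)\<bar> / \<bar>t\<bar>)"
    using False by (simp add: power2_eq_square power3_eq_cube)
  finally show ?thesis by (simp add: kernel_def abs_mult power_abs)
qed

text \<open>The partial sums of a Dirichlet series grow linearly on vertical lines: this is the reason
  for the decay \<open>t\<^sup>-\<^sup>3\<close> of the kernel, gained from the factor \<open>sin (h * t) / t\<close>.\<close>

lemma integrable_kernel_linear:
  assumes "0 < a" "a < b" "0 < h"
  shows "integrable lborel (\<lambda>t. (1 + \<bar>t\<bar>) * \<bar>kernel a b h t\<bar>)"
proof -
  \<comment> \<open>The least factor that compares the scale c with the fixed scale 2, uniformly in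
    t; all three scales are reduced to it.\<close>
  define m where "m c = max 1 (2 / c)" for c :: real
  have m: "1 / (1 + c * \<bar>t\<bar>) \<le> m c / (1 + 2 * \<bar>t\<bar>)" if "0 < c" for c t :: real
  proof -
    have "1 + 2 * \<bar>t\<bar> = 1 + 2 / c * (c * \<bar>t\<bar>)" using that by simp
    also have "\<dots> \<le> m c * 1 + m c * (c * \<bar>t\<bar>)"
      using that unfolding m_def by (intro add_mono mult_right_mono) auto
    finally have "1 + 2 * \<bar>t\<bar> \<le> m c * (1 + c * \<bar>t\<bar>)" by (simp add: algebra_simps)
    then show ?thesis using that by (simp add: divide_simps add_pos_nonneg)
  qed
  have m_pos: "0 < m c" for c by (simp add: m_def)
  define A where "A = 9 / 2 * ((b - a) * (b + a)) * (3 * h) * (m (b - a) * m (b + a) * m (2 * h))"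
  have A_nonneg: "0 \<le> A"
    using assms m_pos[THEN less_imp_le] unfolding A_def by (intro mult_nonneg_nonneg) auto
  have "(1 + \<bar>t\<bar>) * \<bar>kernel a b h t\<bar> \<le> A * (1 / ((1 + \<bar>t\<bar>) * (1 + 2 * \<bar>t\<bar>)))" for t
  proof -
    have s: "\<bar>sin (h * t)\<bar> / \<bar>t\<bar> \<le> 3 * h / (1 + 2 * h * \<bar>t\<bar>)"
    proof (cases "t = 0")
      case False
      then show ?thesis
        using abs_sin_le_ratio[of "h * t"] assms
        by (simp add: pos_divide_le_eq abs_mult mult_ac)
    qed (use assms in auto)
    have "\<bar>kernel a b h t\<bar> \<le> 9 / 2 * ((b - a) * (b + a) / ((1 + (b - a) * \<bar>t\<bar>) * (1 + (b + a) * \<bar>t\<bar>))) * (\<bar>sin (h * t)\<bar> / \<bar>t\<bar>)"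
      by (rule abs_kernel_le[OF assms])
    also have "\<dots> \<le> 9 / 2 * ((b - a) * (b + a) / ((1 + (b - a) * \<bar>t\<bar>) * (1 + (b + a) * \<bar>t\<bar>))) * (3 * h / (1 + 2 * h * \<bar>t\<bar>))"
      using assms by (intro mult_left_mono s mult_nonneg_nonneg divide_nonneg_nonneg add_nonneg_nonneg) auto
    also have "\<dots> = 9 / 2 * ((b - a) * (b + a)) * (3 * h) *
        (1 / (1 + (b - a) * \<bar>t\<bar>) * (1 / (1 + (b + a) * \<bar>t\<bar>)) * (1 / (1 + 2 * h * \<bar>t\<bar>)))"
      by simp
    also have "\<dots> \<le> 9 / 2 * ((b - a) * (b + a)) * (3 * h) *
        (m (b - a) / (1 + 2 * \<bar>t\<bar>) * (m (b + a) / (1 + 2 * \<bar>t\<bar>)) * (m (2 * h) / (1 + 2 * \<bar>t\<bar>)))"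
      using assms m_pos[THEN less_imp_le]
      by (intro mult_left_mono mult_mono m mult_nonneg_nonneg divide_nonneg_nonneg add_nonneg_nonneg) auto
    also have "\<dots> = A / (1 + 2 * \<bar>t\<bar>) ^ 3"
      by (simp add: A_def power3_eq_cube)
    finally have "(1 + \<bar>t\<bar>) * \<bar>kernel a b h t\<bar> \<le> (1 + \<bar>t\<bar>) * (A / (1 + 2 * \<bar>t\<bar>) ^ 3)"
      by (intro mult_left_mono) auto
    also have "\<dots> = A * ((1 + \<bar>t\<bar>) / (1 + 2 * \<bar>t\<bar>) ^ 3)" by simp
    also have "\<dots> \<le> A * (1 / ((1 + \<bar>t\<bar>) * (1 + 2 * \<bar>t\<bar>)))"
    proof (rule mult_left_mono)
      have "(1 + \<bar>t\<bar>) * (1 + \<bar>t\<bar>) \<le> (1 + 2 * \<bar>t\<bar>) * (1 + 2 * \<bar>t\<bar>)"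
        by (intro mult_mono) auto
      then have "((1 + \<bar>t\<bar>) * (1 + \<bar>t\<bar>)) * (1 + 2 * \<bar>t\<bar>) \<le> ((1 + 2 * \<bar>t\<bar>) * (1 + 2 * \<bar>t\<bar>)) * (1 + 2 * \<bar>t\<bar>)"
        by (rule mult_right_mono) auto
      moreover have "0 < 1 + \<bar>t\<bar>" "0 < 1 + 2 * \<bar>t\<bar>" by auto
      ultimately show "(1 + \<bar>t\<bar>) / (1 + 2 * \<bar>t\<bar>) ^ 3 \<le> 1 / ((1 + \<bar>t\<bar>) * (1 + 2 * \<bar>t\<bar>))"
        by (simp add: frac_le_eq divide_nonpos_pos power3_eq_cube mult_ac)
    qed (rule A_nonneg)
    finally show ?thesis .
  qed
  then show ?thesis
    by (intro Bochner_Integration.integrable_bound[OF integrable_mult_right[OF integrable_two_scale_1_2, of A]])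
      (use A_nonneg in \<open>auto simp: abs_mult\<close>)
qed

lemma integrable_kernel:
  assumes "0 < a" "a < b" "0 < h"
  shows "integrable lborel (kernel a b h)"
  by (rule Bochner_Integration.integrable_bound[OF integrable_kernel_linear[OF assms]])
    (auto simp: abs_mult mult_le_cancel_right1)

text \<open>The prefactor h * (b - a) is, up to a constant, the height of the plateau of the
  transform. Relative to that height, a steep transition from a to b costs only a logarithm.\<close>

lemma integral_abs_kernel_le:
  assumes "0 < a" "a < b" "0 < h"
  shows "(\<integral>t. \<bar>kernel a b h t\<bar> \<partial>lborel) \<le> 9 * h * (b - a) * (1 + ln ((b + a) / (b - a)))"
proof -
  define p q where "p = b - a" and "q = b + a"
  have pq: "0 < p" "p < q" using assms by (auto simp: p_def q_def)
  note two_scale = has_bochner_integral_two_scale[OF pq]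
  have le: "\<bar>kernel a b h t\<bar> \<le> 9 / 2 * h * (p * q / ((1 + p * \<bar>t\<bar>) * (1 + q * \<bar>t\<bar>)))" for t
  proof -
    have "\<bar>sin (h * t)\<bar> / \<bar>t\<bar> \<le> h"
    proof (cases "t = 0")
      case False
      then show ?thesis
        using abs_sin_x_le_abs_x[of "h * t"] assms by (simp add: pos_divide_le_eq abs_mult)
    qed (use assms in simp)
    then have "9 / 2 * (p * q / ((1 + p * \<bar>t\<bar>) * (1 + q * \<bar>t\<bar>))) * (\<bar>sin (h * t)\<bar> / \<bar>t\<bar>) \<le>
        9 / 2 * (p * q / ((1 + p * \<bar>t\<bar>) * (1 + q * \<bar>t\<bar>))) * h"
      using pq by (intro mult_left_mono) auto
    then show ?thesis
      using abs_kernel_le[OF assms, of t] by (simp add: p_def q_def mult_ac)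
  qed
  have "(\<integral>t. \<bar>kernel a b h t\<bar> \<partial>lborel) \<le>
      (\<integral>t. 9 / 2 * h * (p * q / ((1 + p * \<bar>t\<bar>) * (1 + q * \<bar>t\<bar>))) \<partial>lborel)"
    using two_scale integrable_kernel[OF assms] le
    by (intro integral_mono integrable_abs integrable_mult_right) (auto simp: has_bochner_integral_iff)
  also have "\<dots> = 9 / 2 * h * (2 * (p * q / (q - p) * ln (q / p)))"
    using two_scale by (simp only: integral_mult_right_zero has_bochner_integral_iff)
  \<comment> \<open>Since q / (q - p) = 1 + p / (q - p), the main term splits off; by ln x <= x - 1
    the remainder is at most p, even when p and q are close.\<close>
  also have "p * q / (q - p) * ln (q / p) = p * ln (q / p) + p * (p * ln (q / p) / (q - p))"
    using pq by (simp add: divide_simps) (simp add: algebra_simps)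
  also have "p * (p * ln (q / p) / (q - p)) \<le> p * 1"
  proof (rule mult_left_mono)
    have "ln (q / p) \<le> q / p - 1" using pq by (intro ln_le_minus_one) auto
    then have "p * ln (q / p) \<le> p * (q / p - 1)" using pq by (intro mult_left_mono) auto
    also have "\<dots> = q - p" using pq by (simp add: algebra_simps)
    finally show "p * ln (q / p) / (q - p) \<le> 1" using pq by simp
  qed (use pq in simp)
  finally show ?thesis using assms by (simp add: p_def q_def algebra_simps)
qed

text \<open>Expanding products into sums, \<open>kernel a b h t * cos (v * t)\<close> becomes a combination of
  \<open>sin (x * t) / t ^ 3\<close>; the linear terms needed to make these integrable cancel, and each integral
  is a multiple of \<open>x * \<bar>x\<bar>\<close>.\<close>

definition kernel_ft :: "real \<Rightarrow> real \<Rightarrow> real \<Rightarrow> real \<Rightarrow> real" where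
  "kernel_ft a b h v = - (sin_cubic_mass / 4) *
     (((a + h + v) * \<bar>a + h + v\<bar> + (a + h - v) * \<bar>a + h - v\<bar>)
    - ((a - h + v) * \<bar>a - h + v\<bar> + (a - h - v) * \<bar>a - h - v\<bar>)
    - ((b + h + v) * \<bar>b + h + v\<bar> + (b + h - v) * \<bar>b + h - v\<bar>)
    + ((b - h + v) * \<bar>b - h + v\<bar> + (b - h - v) * \<bar>b - h - v\<bar>))"

section \<open>Plateau, support and integral formula of the transform\<close>

lemma kernel_ft_plateau:
  assumes "0 < h" "a < b" "\<bar>v\<bar> \<le> a - h"
  shows "kernel_ft a b h v = 2 * sin_cubic_mass * h * (b - a)"
  \<comment> \<open>All eight arguments are nonnegative, so every x * |x| is x^2; the terms in v
    cancel and the mixed terms in a h and b h remain.\<close>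
  using assms unfolding kernel_ft_def
  by (subst (1 2 3 4 5 6 7 8) abs_of_nonneg) (auto simp: algebra_simps)

text \<open>Outside the support the two arguments x + v and x - v of a pair have opposite signs, so
  the pair contributes 4 * x * |v|. The signed sum of x over a + h, a - h, b + h, b - h is
  zero.\<close>

lemma kernel_ft_eq_0:
  assumes "0 < h" "h \<le> a" "a < b" "b + h \<le> \<bar>v\<bar>"
  shows "kernel_ft a b h v = 0"
proof (cases "0 \<le> v")
  case True
  then have "a + h \<le> v" "a - h \<le> v" "b + h \<le> v" "b - h \<le> v" using assms by auto
  then have "\<bar>a + h + v\<bar> = a + h + v" "\<bar>a + h - v\<bar> = v - (a + h)" "\<bar>a - h + v\<bar> = a - h + v" "\<bar>a - h - v\<bar> = v - (a - h)"
    "\<bar>b + h + v\<bar> = b + h + v" "\<bar>b + h - v\<bar> = v - (b + h)" "\<bar>b - h + v\<bar> = b - h + v" "\<bar>b - h - v\<bar> = v - (b - h)"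
    using assms True by auto
  then show ?thesis unfolding kernel_ft_def by (simp only:) (simp add: algebra_simps)
next
  case False
  then have "a + h \<le> - v" "a - h \<le> - v" "b + h \<le> - v" "b - h \<le> - v" using assms by auto
  then have "\<bar>a + h - v\<bar> = a + h - v" "\<bar>a + h + v\<bar> = - v - (a + h)" "\<bar>a - h - v\<bar> = a - h - v" "\<bar>a - h + v\<bar> = - v - (a - h)"
    "\<bar>b + h - v\<bar> = b + h - v" "\<bar>b + h + v\<bar> = - v - (b + h)" "\<bar>b - h - v\<bar> = b - h - v" "\<bar>b - h + v\<bar> = - v - (b - h)"
    using assms False by auto
  then show ?thesis unfolding kernel_ft_def by (simp only:) (simp add: algebra_simps)
qed

lemma has_bochner_integral_kernel_cos:
  "has_bochner_integral lborel (\<lambda>t. kernel a b h t * cos (v * t)) (kernel_ft a b h v)"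
proof -
  define g where "g x t = (x * t - sin (x * t)) / t ^ 3" for x t :: real
  have *: "cos (c * t) * sin (h * t) * cos (v * t) =
      (sin ((c + h + v) * t) + sin ((c + h - v) * t) - sin ((c - h + v) * t) - sin ((c - h - v) * t)) / 4" for c t
    by (simp add: distrib_right left_diff_distrib sin_add sin_diff cos_add cos_diff)
  have kernel_eq: "kernel a b h t * cos (v * t) =
     (cos (a * t) * sin (h * t) * cos (v * t) - cos (b * t) * sin (h * t) * cos (v * t)) / t ^ 3" for t
    by (simp add: kernel_def algebra_simps)
  have "kernel a b h t * cos (v * t) =
     - (1 / 4) * ((g (a + h + v) t + g (a + h - v) t) - (g (a - h + v) t + g (a - h - v) t)
      - (g (b + h + v) t + g (b + h - v) t) + (g (b - h + v) t + g (b - h - v) t))" for t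
  proof -
    \<comment> \<open>The p's are the eight sines and the A's their linear terms. The premise
      amounts to (a + h) - (a - h) - (b + h) + (b - h) = 0, multiplied by 2 t.\<close>
    have id: "((p1 + p2 - p3 - p4) / 4 - (p5 + p6 - p7 - p8) / 4) / T =
        - (1 / 4) * (((A1 - p1) / T + (A2 - p2) / T) - ((A3 - p3) / T + (A4 - p4) / T)
          - ((A5 - p5) / T + (A6 - p6) / T) + ((A7 - p7) / T + (A8 - p8) / T))"
      if "A1 + A2 - A3 - A4 - A5 - A6 + A7 + A8 = 0"
      for p1 p2 p3 p4 p5 p6 p7 p8 A1 A2 A3 A4 A5 A6 A7 A8 T :: real
    proof -
      have "- (1 / 4) * (((A1 - p1) / T + (A2 - p2) / T) - ((A3 - p3) / T + (A4 - p4) / T)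
          - ((A5 - p5) / T + (A6 - p6) / T) + ((A7 - p7) / T + (A8 - p8) / T)) =
        - (1 / 4) * (((A1 + A2 - A3 - A4 - A5 - A6 + A7 + A8)
          - (p1 + p2 - p3 - p4 - (p5 + p6 - p7 - p8))) / T)"
        by (simp add: add_divide_distrib diff_divide_distrib)
      also have "\<dots> = ((p1 + p2 - p3 - p4) / 4 - (p5 + p6 - p7 - p8) / 4) / T"
        unfolding that by (simp add: diff_divide_distrib add_divide_distrib)
      finally show ?thesis ..
    qed
    show ?thesis
      unfolding kernel_eq * g_def by (rule id) (simp add: algebra_simps)
  qed
  moreover have g: "has_bochner_integral lborel (g x) (sin_cubic_mass * (x * \<bar>x\<bar>))" for x
    unfolding g_def by (rule has_bochner_integral_sin_cubic_scaled)
  have "has_bochner_integral lborel (\<lambda>t. - (1 / 4) * ((g (a + h + v) t + g (a + h - v) t) - (g (a - h + v) t + g (a - h - v) t)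
      - (g (b + h + v) t + g (b + h - v) t) + (g (b - h + v) t + g (b - h - v) t)))
    (- (1 / 4) * ((sin_cubic_mass * ((a + h + v) * \<bar>a + h + v\<bar>) + sin_cubic_mass * ((a + h - v) * \<bar>a + h - v\<bar>))
    - (sin_cubic_mass * ((a - h + v) * \<bar>a - h + v\<bar>) + sin_cubic_mass * ((a - h - v) * \<bar>a - h - v\<bar>))
    - (sin_cubic_mass * ((b + h + v) * \<bar>b + h + v\<bar>) + sin_cubic_mass * ((b + h - v) * \<bar>b + h - v\<bar>))
    + (sin_cubic_mass * ((b - h + v) * \<bar>b - h + v\<bar>) + sin_cubic_mass * ((b - h - v) * \<bar>b - h - v\<bar>))))"
    by (intro has_bochner_integral_mult_right has_bochner_integral_add has_bochner_integral_diff g)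
  moreover have "(- (1 / 4) * ((sin_cubic_mass * ((a + h + v) * \<bar>a + h + v\<bar>) + sin_cubic_mass * ((a + h - v) * \<bar>a + h - v\<bar>))
    - (sin_cubic_mass * ((a - h + v) * \<bar>a - h + v\<bar>) + sin_cubic_mass * ((a - h - v) * \<bar>a - h - v\<bar>))
    - (sin_cubic_mass * ((b + h + v) * \<bar>b + h + v\<bar>) + sin_cubic_mass * ((b + h - v) * \<bar>b + h - v\<bar>))
    + (sin_cubic_mass * ((b - h + v) * \<bar>b - h + v\<bar>) + sin_cubic_mass * ((b - h - v) * \<bar>b - h - v\<bar>)))) = kernel_ft a b h v"
    unfolding kernel_ft_def distrib_left[symmetric] right_diff_distrib[symmetric] by simp
  ultimately show ?thesis by (simp only:)
qed

text \<open>The kernel is even, so the sine part of the exponential integrates to zero and the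
  cosine integral is the whole Fourier transform.\<close>

lemma has_bochner_integral_kernel_exp:
  assumes "0 < a" "a < b" "0 < h"
  shows "has_bochner_integral lborel (\<lambda>t. of_real (kernel a b h t) * exp (- (\<i> * of_real (v * t))))
           (complex_of_real (kernel_ft a b h v))"
proof -
  have int: "integrable lborel (\<lambda>t. kernel a b h t * sin (v * t))"
    by (rule Bochner_Integration.integrable_bound[OF integrable_kernel[OF assms]])
      (auto simp: abs_mult mult_left_le)
  have even: "kernel a b h (- t) = kernel a b h t" for t by (simp add: kernel_def)
  have "(\<integral>t. kernel a b h t * sin (v * t) \<partial>lborel) = (\<integral>t. kernel a b h (0 + - 1 * t) * sin (v * (0 + - 1 * t)) \<partial>lborel)"
    using lborel_integral_real_affine[of "- 1" "\<lambda>t. kernel a b h t * sin (v * t)" 0] by simp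
  then have "(\<integral>t. kernel a b h t * sin (v * t) \<partial>lborel) = 0"
    by (simp add: even)
  with int have "has_bochner_integral lborel (\<lambda>t. kernel a b h t * sin (v * t)) 0"
    by (simp add: has_bochner_integral_iff)
  then have "has_bochner_integral lborel (\<lambda>t. complex_of_real (kernel a b h t * cos (v * t)) -
      \<i> * complex_of_real (kernel a b h t * sin (v * t))) (complex_of_real (kernel_ft a b h v) - \<i> * complex_of_real 0)"
    by (intro has_bochner_integral_diff has_bochner_integral_mult_right has_bochner_integral_of_real
        has_bochner_integral_kernel_cos)
  moreover have "complex_of_real (kernel a b h t * cos (v * t)) - \<i> * complex_of_real (kernel a b h t * sin (v * t))
      = of_real (kernel a b h t) * exp (- (\<i> * of_real (v * t)))" for t
    by (simp add: complex_eq_iff exp_minus Re_exp Im_exp flip: exp_minus)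
  ultimately show ?thesis by simp
qed

section \<open>Abel summation\<close>

lemma sum_by_parts:
  fixes c e :: "nat \<Rightarrow> 'a::comm_ring"
  assumes "m \<le> k"
  shows "(\<Sum>n=m..<k. c n * e n) =
    (\<Sum>n=m..<k. c n) * e k + (\<Sum>n=m..<k. (\<Sum>i=m..<Suc n. c i) * (e n - e (Suc n)))"
  using assms
proof (induction k rule: dec_induct)
  case (step k)
  then show ?case by (simp add: algebra_simps)
qed simp

text \<open>The difference is the integral of w * exp (- u w) over u in [x, y], and the modulus is
  taken inside. The resulting bound telescopes along a monotone sequence, at the price of the factor
  |w| / Re w.\<close>

lemma norm_exp_diff_le:
  fixes w :: complex
  assumes "0 < Re w" "x \<le> y"
  shows "norm (exp (- (of_real x * w)) - exp (- (of_real y * w))) \<le>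
    norm w / Re w * (exp (- (x * Re w)) - exp (- (y * Re w)))"
proof -
  have 1: "((\<lambda>u. w * exp (- (of_real u * w))) has_integral
      (- exp (- (of_real y * w))) - (- exp (- (of_real x * w)))) {x..y}"
  proof (rule fundamental_theorem_of_calculus[OF assms(2)])
    fix u
    have "((\<lambda>z. - exp (- (z * w))) has_field_derivative w * exp (- (of_real u * w))) (at (of_real u))"
      by (auto intro!: derivative_eq_intros)
    from has_vector_derivative_real_field[OF this]
    show "((\<lambda>u. - exp (- (of_real u * w))) has_vector_derivative w * exp (- (of_real u * w))) (at u within {x..y})"
      by (auto simp: o_def intro: has_vector_derivative_at_within)
  qed
  have 2: "((\<lambda>u. norm w * exp (- (u * Re w))) has_integral
      (- (norm w / Re w * exp (- (y * Re w)))) - (- (norm w / Re w * exp (- (x * Re w))))) {x..y}"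
  proof (rule fundamental_theorem_of_calculus[OF assms(2)])
    fix u
    show "((\<lambda>u. - (norm w / Re w * exp (- (u * Re w)))) has_vector_derivative norm w * exp (- (u * Re w))) (at u within {x..y})"
      using assms(1) unfolding has_real_derivative_iff_has_vector_derivative[symmetric]
      by (auto intro!: derivative_eq_intros)
  qed
  have "norm (integral {x..y} (\<lambda>u. w * exp (- (of_real u * w)))) \<le> integral {x..y} (\<lambda>u. norm w * exp (- (u * Re w)))"
    using 1 2 by (intro integral_norm_bound_integral) (auto simp: norm_mult)
  then have "norm ((- exp (- (of_real y * w))) - (- exp (- (of_real x * w)))) \<le>
      (- (norm w / Re w * exp (- (y * Re w)))) - (- (norm w / Re w * exp (- (x * Re w))))"
    unfolding integral_unique[OF 1] integral_unique[OF 2] .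
  then show ?thesis by (simp add: right_diff_distrib)
qed

text \<open>Abel summation with telescoping differences. On a vertical line the factor |w| / Re w
  grows linearly, which is the growth that the kernel has to absorb.\<close>

lemma norm_sum_exp_le:
  fixes c :: "nat \<Rightarrow> complex"
  assumes "mono l" "\<And>n. 0 \<le> l n" "0 < Re w" "\<And>k. norm (\<Sum>n<k. c n) \<le> B"
  shows "norm (\<Sum>n<k. c n * exp (- (of_real (l n) * w))) \<le> B * (norm w / Re w)"
proof -
  define e where "e n = exp (- (of_real (l n) * w))" for n
  define E where "E n = exp (- (l n * Re w))" for n
  have B: "0 \<le> B" using assms(4)[of 0] by simp
  have ratio: "1 \<le> norm w / Re w" using assms(3) complex_Re_le_cmod[of w] by simp
  have norm_e: "norm (e n) = E n" and E_nonneg: "0 \<le> E n" for n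
    by (simp_all add: e_def E_def)
  have diff: "norm (e n - e (Suc n)) \<le> norm w / Re w * (E n - E (Suc n))" for n
    unfolding e_def E_def using assms(3) monoD[OF assms(1), of n "Suc n"]
    by (intro norm_exp_diff_le) auto
  have "(\<Sum>n<k. c n * e n) = (\<Sum>n<k. c n) * e k + (\<Sum>n<k. (\<Sum>i<Suc n. c i) * (e n - e (Suc n)))"
    using sum_by_parts[of 0 k c e] by (simp add: atLeast0LessThan)
  also have "norm \<dots> \<le> B * E k + (\<Sum>n<k. B * (norm w / Re w * (E n - E (Suc n))))"
    using assms(4) B diff
    by (intro norm_triangle_le add_mono sum_norm_le order_trans[OF norm_mult_ineq] mult_mono)
      (auto simp: norm_e E_nonneg simp del: sum.lessThan_Suc)
  also have "(\<Sum>n<k. B * (norm w / Re w * (E n - E (Suc n)))) = B * (norm w / Re w) * (E 0 - E k)"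
    by (simp only: mult.assoc[symmetric] sum_distrib_left[symmetric] sum_lessThan_telescope')
  \<comment> \<open>As |w| / Re w >= 1, the boundary term may be enlarged to the missing piece of
    the telescoping sum.\<close>
  also have "B * E k + B * (norm w / Re w) * (E 0 - E k) \<le> B * (norm w / Re w) * E k + B * (norm w / Re w) * (E 0 - E k)"
    using mult_right_mono[OF mult_left_mono[OF ratio B] E_nonneg[of k]] by simp
  also have "\<dots> = B * (norm w / Re w) * E 0"
    by (simp only: right_diff_distrib add_diff_eq add_diff_cancel_left')
  also have "\<dots> \<le> B * (norm w / Re w) * 1"
    using B ratio assms(2,3) by (intro mult_left_mono) (auto simp: E_def)
  finally show ?thesis by (simp add: e_def)
qed

text \<open>With E n = exp (- d l n), the sums grow like 1 / E n and the weights are E n ^ 2. Abel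
  summation leaves (E n ^ 2 - E (n+1) ^ 2) / E n <= 2 * (E n - E (n+1)), which telescopes down to E
  m.\<close>

lemma norm_sum_exp_tail_le:
  fixes c :: "nat \<Rightarrow> complex"
  assumes "mono l" "0 < d" "m \<le> k" "0 \<le> B"
    "\<And>k. m \<le> k \<Longrightarrow> norm (\<Sum>n=m..<Suc k. c n) \<le> B * exp (d * l k)"
  shows "norm (\<Sum>n=m..<k. c n * of_real (exp (- (2 * d * l n)))) \<le> 2 * B * exp (- (d * l m))"
proof -
  define E where "E n = exp (- (d * l n))" for n
  have E_pos: "0 < E n" for n by (simp add: E_def)
  have E_antimono: "E n \<le> E m" if "m \<le> n" for m n
    using assms(1,2) that by (auto simp: E_def dest: monoD)
  have E2: "exp (- (2 * d * l n)) = E n * E n" for n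
    by (simp add: E_def flip: exp_add)
  have A: "norm (\<Sum>n=m..<Suc n. c n) \<le> B / E n" if "m \<le> n" for n
    using assms(5)[OF that] by (simp add: E_def exp_minus field_simps)
  \<comment> \<open>A nonempty sum ends at index k - 1, where the growth bound is applied before
    passing to k. The factor 2 is slack, matching the telescoping terms of
    \<open>mid\<close>.\<close>
  have last: "norm ((\<Sum>n=m..<k. c n) * of_real (E k * E k)) \<le> 2 * B * E k"
  proof (cases "k = m")
    case True
    then show ?thesis using E_pos[of k] assms(4) by simp
  next
    case False
    with assms(3) obtain j where j: "k = Suc j" "m \<le> j" by (cases k) auto
    have "norm ((\<Sum>n=m..<k. c n) * of_real (E k * E k)) \<le> B / E j * (E k * E k)"
      using A[OF j(2)] E_pos[of k] E_pos[of j] assms(4) unfolding j(1) norm_mult[of "sum c _"]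
      by (intro mult_mono) (auto simp: norm_mult)
    also have "\<dots> \<le> B / E k * (E k * E k)"
      using assms(4) E_pos E_antimono[of j k] j
      by (intro mult_right_mono divide_left_mono) auto
    also have "\<dots> \<le> 2 * B * E k" using E_pos[of k] assms(4) by simp
    finally show ?thesis .
  qed
  have mid: "norm ((\<Sum>i=m..<Suc n. c i) * of_real (E n * E n - E (Suc n) * E (Suc n))) \<le> 2 * B * (E n - E (Suc n))"
    if "m \<le> n" for n
  proof -
    have le: "E (Suc n) \<le> E n" by (rule E_antimono) simp
    have eq: "E n * E n - E (Suc n) * E (Suc n) = (E n + E (Suc n)) * (E n - E (Suc n))"
      by (simp add: algebra_simps)
    have "norm ((\<Sum>i=m..<Suc n. c i) * of_real (E n * E n - E (Suc n) * E (Suc n)))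
        = norm (\<Sum>i=m..<Suc n. c i) * ((E n + E (Suc n)) * (E n - E (Suc n)))"
      unfolding eq norm_mult norm_of_real using E_pos[of n] E_pos[of "Suc n"] le by (simp add: abs_mult)
    also have "\<dots> \<le> B / E n * ((E n + E n) * (E n - E (Suc n)))"
      using A[OF that] E_pos[of n] E_pos[of "Suc n"] le assms(4)
      by (intro mult_mono) auto
    also have "\<dots> = 2 * B * (E n - E (Suc n))" using E_pos[of n] by (simp add: field_simps)
    finally show ?thesis .
  qed
  have "(\<Sum>n=m..<k. c n * of_real (exp (- (2 * d * l n)))) = (\<Sum>n=m..<k. c n) * of_real (E k * E k)
      + (\<Sum>n=m..<k. (\<Sum>i=m..<Suc n. c i) * (of_real (E n * E n) - of_real (E (Suc n) * E (Suc n))))"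
    unfolding E2 by (rule sum_by_parts[OF assms(3)])
  also have "norm \<dots> \<le> 2 * B * E k + (\<Sum>n=m..<k. 2 * B * (E n - E (Suc n)))"
    using last mid unfolding of_real_diff[symmetric]
    by (intro norm_triangle_le add_mono sum_norm_le) auto
  also have "(\<Sum>n=m..<k. 2 * B * (E n - E (Suc n))) = 2 * B * (E m - E k)"
    using sum_Suc_diff'[of m k "\<lambda>n. - E n"] assms(3) by (simp add: sum_distrib_left[symmetric])
  finally show ?thesis by (simp add: E_def algebra_simps)
qed

section \<open>Smoothed partial sums\<close>

lemma sums_dirichlet_sum:
  "a \<in> D_infty l \<Longrightarrow> 0 < Re s \<Longrightarrow> dirichlet_term l a s sums dirichlet_sum l a s"
  by (auto simp: D_infty_def dirichlet_sum_def intro: summable_sums)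

lemma dirichlet_term_add:
  "dirichlet_term l a (s + w) n = dirichlet_term l a s n * exp (- (of_real (l n) * w))"
  by (simp add: dirichlet_term_def distrib_left exp_add exp_minus field_simps flip: exp_add)

lemma borel_measurable_dirichlet_term [measurable]:
  "(\<lambda>t. dirichlet_term l a (s + \<i> * complex_of_real t) n) \<in> borel_measurable borel"
  unfolding dirichlet_term_def
  by (intro borel_measurable_continuous_onI continuous_intros)

text \<open>Integrating D (s + i t) against the kernel, modulated by exp (i v t), multiplies the
  n-th term by the transform at l n - v. From N on these factors vanish, so the integrals of the
  partial sums are eventually constant; dominated convergence identifies their value with the
  integral of D itself, where the bound M applies.\<close>

lemma norm_smoothed_sum_le:
  assumes "frequency l" "a \<in> D_infty l" "\<And>s. 0 < Re s \<Longrightarrow> norm (dirichlet_sum l a s) \<le> M"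
    and "0 < h" "h \<le> c" "c < d" "\<And>n. N \<le> n \<Longrightarrow> v + d + h \<le> l n" "0 < Re s"
  shows "norm (\<Sum>n<N. dirichlet_term l a s n * of_real (kernel_ft c d h (l n - v)))
    \<le> M * (\<integral>t. \<bar>kernel c d h t\<bar> \<partial>lborel)"
proof -
  define K where "K t = of_real (kernel c d h t) * exp (\<i> * of_real (v * t))" for t
  define S where "S n t = (\<Sum>k<n. dirichlet_term l a (s + \<i> * of_real t) k) * K t" for n t
  define f where "f t = dirichlet_sum l a (s + \<i> * of_real t) * K t" for t
  have c: "0 < c" using assms by simp
  have norm_K: "norm (K t) = \<bar>kernel c d h t\<bar>" for t by (simp add: K_def norm_mult)
  have K_meas [measurable]: "K \<in> borel_measurable borel"
  proof -
    have [measurable]: "(\<lambda>t. exp (\<i> * complex_of_real (v * t))) \<in> borel_measurable borel"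
      by (intro borel_measurable_continuous_onI continuous_intros)
    show ?thesis unfolding K_def by measurable
  qed
  have S_meas [measurable]: "S n \<in> borel_measurable borel" for n
    unfolding S_def by measurable
  have lim: "(\<lambda>n. S n t) \<longlonglongrightarrow> f t" for t
    using sums_dirichlet_sum[OF assms(2), of "s + \<i> * of_real t"] assms(8)
    unfolding S_def f_def sums_def by (intro tendsto_mult tendsto_const) simp
  have f_meas [measurable]: "f \<in> borel_measurable borel"
    by (rule borel_measurable_LIMSEQ_metric[OF S_meas lim])
  have "has_bochner_integral lborel (\<lambda>t. \<Sum>k<n. dirichlet_term l a s k *
        (of_real (kernel c d h t) * exp (- (\<i> * of_real ((l k - v) * t)))))
      (\<Sum>k<n. dirichlet_term l a s k * of_real (kernel_ft c d h (l k - v)))" for n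
    by (intro has_bochner_integral_sum has_bochner_integral_mult_right
        has_bochner_integral_kernel_exp[OF c assms(6,4)])
  moreover have "dirichlet_term l a s k * (of_real (kernel c d h t) * exp (- (\<i> * of_real ((l k - v) * t))))
      = dirichlet_term l a (s + \<i> * of_real t) k * K t" for k t
  proof -
    have "exp (- (\<i> * of_real ((l k - v) * t))) = exp (- (of_real (l k) * (\<i> * of_real t))) * exp (\<i> * of_real (v * t))"
      by (simp add: algebra_simps flip: exp_add)
    then show ?thesis by (simp add: K_def dirichlet_term_add)
  qed
  ultimately have int_S: "(\<integral>t. S n t \<partial>lborel) = (\<Sum>k<n. dirichlet_term l a s k * of_real (kernel_ft c d h (l k - v)))" for n
    by (simp add: S_def sum_distrib_right has_bochner_integral_integral_eq)
  have stable: "(\<Sum>k<n. dirichlet_term l a s k * of_real (kernel_ft c d h (l k - v)))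
      = (\<Sum>k<N. dirichlet_term l a s k * of_real (kernel_ft c d h (l k - v)))" if "N \<le> n" for n
  proof (intro sum.mono_neutral_right)
    show "\<forall>k\<in>{..<n} - {..<N}. dirichlet_term l a s k * of_real (kernel_ft c d h (l k - v)) = 0"
    proof
      fix k assume "k \<in> {..<n} - {..<N}"
      then have "v + d + h \<le> l k" by (intro assms(7)) auto
      then have "kernel_ft c d h (l k - v) = 0"
        using assms(4-6) by (intro kernel_ft_eq_0) auto
      then show "dirichlet_term l a s k * of_real (kernel_ft c d h (l k - v)) = 0" by simp
    qed
  qed (use that in auto)
  have eventually_const: "(\<lambda>n. \<integral>t. S n t \<partial>lborel) \<longlonglongrightarrow> (\<Sum>k<N. dirichlet_term l a s k * of_real (kernel_ft c d h (l k - v)))"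
    unfolding int_S by (intro tendsto_eventually eventually_sequentiallyI[of N] stable)

  \<comment> \<open>Partial sums are bounded at the convergence point \<open>s0\<close>, which lies
    strictly to the left of the line of integration; Abel summation carries this to the line with
    growth linear in t. That supplies the dominating function.\<close>
  define s0 where "s0 = complex_of_real (Re s / 2)"
  have "Bseq (\<lambda>n. \<Sum>k<n. dirichlet_term l a s0 k)"
    using sums_dirichlet_sum[OF assms(2), of s0] assms(8)
    by (intro convergent_imp_Bseq) (auto simp: s0_def sums_def convergent_def)
  then obtain B where B: "0 < B" "\<And>n. norm (\<Sum>k<n. dirichlet_term l a s0 k) \<le> B"
    by (auto simp: Bseq_def)
  define B' where "B' = B * ((norm (s - s0) + 1) / (Re s / 2))"
  have partial: "norm (\<Sum>k<n. dirichlet_term l a (s + \<i> * of_real t) k) \<le> B' * (1 + \<bar>t\<bar>)" for n t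
  proof -
    define w where "w = s - s0 + \<i> * of_real t"
    have w: "Re w = Re s / 2" by (simp add: w_def s0_def)
    have "norm w \<le> norm (s - s0) + \<bar>t\<bar>"
      unfolding w_def by (rule order_trans[OF norm_triangle_ineq]) (simp add: norm_mult)
    also have "\<dots> \<le> (norm (s - s0) + 1) * (1 + \<bar>t\<bar>)" by (simp add: algebra_simps)
    finally have "B * (norm w / Re w) \<le> B * ((norm (s - s0) + 1) * (1 + \<bar>t\<bar>) / Re w)"
      using B(1) assms(8) by (intro mult_left_mono divide_right_mono) (auto simp: w)
    moreover have "norm (\<Sum>k<n. dirichlet_term l a s0 k * exp (- (of_real (l k) * w))) \<le> B * (norm w / Re w)"
      using assms(1,8) B(2) by (intro norm_sum_exp_le) (auto simp: w frequency_def strict_mono_mono)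
    moreover have "s0 + w = s + \<i> * of_real t" by (simp add: w_def)
    moreover have "B * ((norm (s - s0) + 1) * (1 + \<bar>t\<bar>) / Re w) = B' * (1 + \<bar>t\<bar>)"
      unfolding B'_def w by (simp only: mult.assoc times_divide_eq_left)
    ultimately show ?thesis
      unfolding dirichlet_term_add[symmetric] by (metis order_trans)
  qed
  have "(\<lambda>n. \<integral>t. S n t \<partial>lborel) \<longlonglongrightarrow> (\<integral>t. f t \<partial>lborel)"
  proof (rule integral_dominated_convergence)
    show "integrable lborel (\<lambda>t. B' * ((1 + \<bar>t\<bar>) * \<bar>kernel c d h t\<bar>))"
      by (intro integrable_mult_right integrable_kernel_linear c assms)
    show "AE t in lborel. norm (S n t) \<le> B' * ((1 + \<bar>t\<bar>) * \<bar>kernel c d h t\<bar>)" for n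
    proof (rule AE_I2)
      fix t
      show "norm (S n t) \<le> B' * ((1 + \<bar>t\<bar>) * \<bar>kernel c d h t\<bar>)"
        using mult_right_mono[OF partial[of t n], of "\<bar>kernel c d h t\<bar>"]
        by (simp add: S_def norm_mult norm_K mult.assoc)
    qed
  qed (auto intro: lim)
  with eventually_const have "(\<Sum>k<N. dirichlet_term l a s k * of_real (kernel_ft c d h (l k - v))) = (\<integral>t. f t \<partial>lborel)"
    by (rule LIMSEQ_unique)
  also have "norm \<dots> \<le> (\<integral>t. M * \<bar>kernel c d h t\<bar> \<partial>lborel)"
  proof (rule Bochner_Integration.integral_norm_bound_integral)
    have le: "norm (f t) \<le> M * \<bar>kernel c d h t\<bar>" for t
      unfolding f_def norm_mult norm_K using assms(8) by (intro mult_right_mono assms(3)) auto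
    then show "norm (f t) \<le> M * \<bar>kernel c d h t\<bar>" for t .
    show int: "integrable lborel (\<lambda>t. M * \<bar>kernel c d h t\<bar>)"
      by (intro integrable_mult_right integrable_abs integrable_kernel c assms)
    show "integrable lborel f"
      by (rule Bochner_Integration.integrable_bound[OF int])
        (use le in \<open>auto intro: order_trans[OF _ abs_ge_self]\<close>)
  qed
  finally show ?thesis by simp
qed

text \<open>The norm bound in pointwise form, as the integral estimates use it.\<close>

definition bounded_series :: "(nat \<Rightarrow> real) \<Rightarrow> real \<Rightarrow> (nat \<Rightarrow> complex) set" where
  "bounded_series l M = {a \<in> D_infty l. \<forall>s. 0 < Re s \<longrightarrow> norm (dirichlet_sum l a s) \<le> M}"

lemma bounded_series_nonneg: "a \<in> bounded_series l M \<Longrightarrow> 0 \<le> M"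
  using order_trans[OF norm_ge_zero, of "dirichlet_sum l a 1" M] by (simp add: bounded_series_def)

text \<open>The prefactor 9 h (d - c) of the L^1 bound divided by the plateau height 2
  \<open>sin_cubic_mass\<close> h (d - c); the window parameters drop out.\<close>

definition kernel_const :: real where
  "kernel_const = 9 / (2 * sin_cubic_mass)"

lemma kernel_const_pos: "0 < kernel_const"
  using sin_cubic_mass_pos by (simp add: kernel_const_def)

lemma norm_smoothed_sum_le_ln:
  assumes "frequency l" "a \<in> bounded_series l M" "0 < h" "h \<le> c" "c < d"
    "\<And>n. N \<le> n \<Longrightarrow> v + d + h \<le> l n" "0 < Re s"
  shows "norm (\<Sum>n<N. dirichlet_term l a s n * of_real (kernel_ft c d h (l n - v)))
    \<le> (2 * sin_cubic_mass * h * (d - c)) * (M * kernel_const * (1 + ln ((d + c) / (d - c))))"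
proof -
  have "norm (\<Sum>n<N. dirichlet_term l a s n * of_real (kernel_ft c d h (l n - v)))
      \<le> M * (\<integral>t. \<bar>kernel c d h t\<bar> \<partial>lborel)"
    using assms by (intro norm_smoothed_sum_le) (auto simp: bounded_series_def)
  also have "\<dots> \<le> M * (9 * h * (d - c) * (1 + ln ((d + c) / (d - c))))"
    using assms bounded_series_nonneg by (intro mult_left_mono integral_abs_kernel_le) auto
  also have "\<dots> = (2 * sin_cubic_mass * h * (d - c)) * (M * kernel_const * (1 + ln ((d + c) / (d - c))))"
    using sin_cubic_mass_pos by (simp add: kernel_const_def field_simps)
  finally show ?thesis .
qed

section \<open>Growth of partial sums\<close>

text \<open>The transform descends entirely inside the gap: the plateau ends at c - h = l k, and the
  support at d + h = l k + g, which is at most l (k+1). So the smoothed sum is the partial sum times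
  the plateau height.\<close>

lemma norm_partial_sum_gap_le:
  assumes "frequency l" "a \<in> bounded_series l M" "0 < g" "g \<le> l (Suc k) - l k" "0 < Re s"
  shows "norm (\<Sum>n<Suc k. dirichlet_term l a s n) \<le> M * kernel_const * (1 + ln ((6 * l k + 3 * g) / g))"
proof -
  define h c d where "h = g / 3" and "c = l k + h" and "d = l k + 2 * h"
  define A where "A = 2 * sin_cubic_mass * h * (d - c)"
  have mono: "mono l" and nonneg: "0 \<le> l n" for n
    using assms(1) by (auto simp: frequency_def strict_mono_mono)
  have h: "0 < h" using assms(3) by (simp add: h_def)
  have A: "0 < A" using h sin_cubic_mass_pos by (simp add: A_def c_def d_def)
  have "kernel_ft c d h (l n - 0) = A" if "n < Suc k" for n
    unfolding A_def using h nonneg[of n] monoD[OF mono, of n k] that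
    by (intro kernel_ft_plateau) (auto simp: c_def d_def)
  then have "(\<Sum>n<Suc k. dirichlet_term l a s n * of_real (kernel_ft c d h (l n - 0)))
      = (\<Sum>n<Suc k. dirichlet_term l a s n) * of_real A"
    unfolding sum_distrib_right by (intro sum.cong) auto
  moreover have "norm (\<Sum>n<Suc k. dirichlet_term l a s n * of_real (kernel_ft c d h (l n - 0)))
      \<le> A * (M * kernel_const * (1 + ln ((d + c) / (d - c))))"
    unfolding A_def
  proof (rule norm_smoothed_sum_le_ln[OF assms(1,2) h _ _ _ assms(5)])
    fix n assume "Suc k \<le> n"
    then have "l (Suc k) \<le> l n" by (rule monoD[OF mono])
    with assms(4) show "0 + d + h \<le> l n" by (simp add: d_def h_def)
  qed (use h nonneg in \<open>auto simp: c_def d_def\<close>)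
  ultimately have "norm (\<Sum>n<Suc k. dirichlet_term l a s n) * A \<le> (M * kernel_const * (1 + ln ((d + c) / (d - c)))) * A"
    using A by (simp only: norm_mult norm_of_real abs_of_pos mult.commute)
  then have "norm (\<Sum>n<Suc k. dirichlet_term l a s n) \<le> M * kernel_const * (1 + ln ((d + c) / (d - c)))"
    using A by (rule mult_right_le_imp_le)
  also have "(d + c) / (d - c) = (6 * l k + 3 * g) / g"
    using assms(3) by (simp add: c_def d_def h_def field_simps)
  finally show ?thesis .
qed

text \<open>A window centred at l k and narrower than the distance to its neighbours isolates one
  term. With c = h and d = 2 h the ratio (d + c) / (d - c) is 3 at every scale, so the bound is
  independent of the gaps.\<close>

lemma norm_dirichlet_term_le:
  assumes "frequency l" "a \<in> bounded_series l M" "0 < Re s"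
  shows "norm (dirichlet_term l a s k) \<le> M * kernel_const * (1 + ln 3)"
proof -
  have mono: "mono l" and less: "l i < l j" if "i < j" for i j
    using assms(1) that by (auto simp: frequency_def strict_mono_mono strict_mono_less)
  \<comment> \<open>At k = 0 there is no left neighbour; k - 1 would be 0 again and give distance
    0.\<close>
  define g where "g = (if k = 0 then l (Suc k) - l k else min (l (Suc k) - l k) (l k - l (k - 1)))"
  have g: "0 < g" using less[of k "Suc k"] less[of "k - 1" k] by (auto simp: g_def)
  have g_le: "g \<le> l n - l k" if "k < n" for n
    using monoD[OF mono, of k "Suc k" "Suc k" n] that by (auto simp: g_def)
  have g_le': "g \<le> l k - l n" if "n < k" for n
  proof -
    have "l n \<le> l (k - 1)" using that by (intro monoD[OF mono, of k "Suc k"]) auto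
    then show ?thesis using that by (auto simp: g_def)
  qed
  define h where "h = g / 3"
  define A where "A = 2 * sin_cubic_mass * h * (2 * h - h)"
  have h: "0 < h" using g by (simp add: h_def)
  have A: "0 < A" using h sin_cubic_mass_pos by (simp add: A_def)
  have "kernel_ft h (2 * h) h (l n - l k) = 0" if "n < k" for n
    using h g_le'[OF that] by (intro kernel_ft_eq_0) (auto simp: h_def)
  moreover have "kernel_ft h (2 * h) h (l k - l k) = A"
    unfolding A_def using h by (intro kernel_ft_plateau) auto
  ultimately have "(\<Sum>n<Suc k. dirichlet_term l a s n * of_real (kernel_ft h (2 * h) h (l n - l k)))
      = dirichlet_term l a s k * of_real A"
    by simp
  moreover have "norm (\<Sum>n<Suc k. dirichlet_term l a s n * of_real (kernel_ft h (2 * h) h (l n - l k)))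
      \<le> A * (M * kernel_const * (1 + ln ((2 * h + h) / (2 * h - h))))"
    unfolding A_def
  proof (rule norm_smoothed_sum_le_ln[OF assms(1,2) h _ _ _ assms(3)])
    fix n assume "Suc k \<le> n"
    then show "l k + 2 * h + h \<le> l n" using g_le[of n] by (simp add: h_def)
  qed (use h in auto)
  ultimately have "norm (dirichlet_term l a s k) * A \<le> (M * kernel_const * (1 + ln ((2 * h + h) / (2 * h - h)))) * A"
    using A by (simp only: norm_mult norm_of_real abs_of_pos mult.commute)
  then have "norm (dirichlet_term l a s k) \<le> M * kernel_const * (1 + ln ((2 * h + h) / (2 * h - h)))"
    using A by (rule mult_right_le_imp_le)
  also have "(2 * h + h) / (2 * h - h) = 3" using h by simp
  finally show ?thesis .
qed

section \<open>Rational independence and Kronecker's theorem\<close>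

lemma independent_scaled_frequency:
  assumes "rat_independent l" "inj l"
  shows "module.independent (\<lambda>r. (*) (real_of_int r)) ((\<lambda>i. l i / (2 * pi)) ` {..<N})"
proof -
  interpret module "\<lambda>r. (*) (real_of_int r)"
    by (simp add: module.intro distrib_left mult.commute)
  \<comment> \<open>Division by 2 pi turns phases modulo 2 pi into numbers modulo 1, the setting of
    Kronecker's theorem.\<close>
  define f where "f i = l i / (2 * pi)" for i
  have inj: "inj_on f X" for X
    using assms(2) by (auto simp: f_def inj_on_def)
  have "independent (f ` {..<N})"
    unfolding independent_explicit_module
  proof (intro allI impI)
    fix T u v
    assume T: "finite T" "T \<subseteq> f ` {..<N}" "(\<Sum>v\<in>T. real_of_int (u v) * v) = 0" "v \<in> T"
    \<comment> \<open>An integer relation among values becomes a rational relation among indices,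
      with coefficient 0 off T; injectivity justifies the reindexing.\<close>
    define q :: "nat \<Rightarrow> rat" where "q i = (if f i \<in> T then of_int (u (f i)) else 0)" for i
    define I where "I = {i \<in> {..<N}. f i \<in> T}"
    have T_eq: "T = f ` I" using T(2) by (auto simp: I_def)
    have "(\<Sum>i<N. of_rat (q i) * l i) = (\<Sum>i\<in>I. of_rat (q i) * l i)"
      by (rule sum.mono_neutral_right) (auto simp: I_def q_def)
    also have "\<dots> = (\<Sum>i\<in>I. 2 * pi * (real_of_int (u (f i)) * f i))"
      by (rule sum.cong) (auto simp: I_def q_def f_def)
    also have "\<dots> = 2 * pi * (\<Sum>v\<in>T. real_of_int (u v) * v)"
      unfolding T_eq sum.reindex[OF inj] by (simp add: sum_distrib_left)
    finally have "(\<Sum>i<N. of_rat (q i) * l i) = 0" using T(3) by simp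
    with assms(1) have "\<forall>i<N. q i = 0" unfolding rat_independent_def by blast
    moreover obtain i where "i < N" "v = f i" using T(2,4) by auto
    ultimately show "u v = 0" using T(4) by (auto simp: q_def)
  qed
  then show ?thesis by (simp add: f_def)
qed

text \<open>By Kronecker's theorem all terms can be rotated simultaneously towards the positive reals.\<close>

lemma sum_norm_le_of_bounded_exponential_sum:
  fixes c :: "nat \<Rightarrow> complex"
  assumes "rat_independent l" "inj l"
    and bound: "\<And>t. norm (\<Sum>n<N. c n * exp (- (\<i> * of_real (l n * t)))) \<le> C"
  shows "(\<Sum>n<N. norm (c n)) \<le> C"
proof (rule field_le_epsilon)
  fix e :: real assume "0 < e"
  define S where "S = (\<Sum>n<N. norm (c n))"
  \<comment> \<open>The total loss S * 2 pi \<epsilon> then equals e * S / (S + 1) <= e; S + 1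
    covers the case S = 0.\<close>
  define \<epsilon> where "\<epsilon> = e / (2 * pi * (S + 1))"
  have S: "0 \<le> S" by (simp add: S_def sum_nonneg)
  have \<epsilon>: "0 < \<epsilon>" using \<open>0 < e\<close> S by (simp add: \<epsilon>_def)
  have inj: "inj_on (\<lambda>i. l i / (2 * pi)) {..<N}"
    using assms(2) by (auto simp: inj_on_def)
  obtain t m where tm: "\<And>i. i < N \<Longrightarrow> \<bar>t * (l i / (2 * pi)) - of_int (m i) - Arg (c i) / (2 * pi)\<bar> < \<epsilon>"
    using Kronecker_thm_1[OF independent_scaled_frequency[OF assms(1,2)] inj \<epsilon>, of "\<lambda>i. Arg (c i) / (2 * pi)"]
    by metis
  have cos_ge: "1 - \<bar>x\<bar> \<le> cos x" for x :: real
  proof -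
    have "(sin (x / 2))\<^sup>2 \<le> \<bar>sin (x / 2)\<bar>"
      using mult_left_le[of "\<bar>sin (x / 2)\<bar>" "\<bar>sin (x / 2)\<bar>"] by (simp add: power2_eq_square abs_mult_self_eq)
    moreover have "\<bar>sin (x / 2)\<bar> \<le> \<bar>x\<bar> / 2" using abs_sin_x_le_abs_x[of "x / 2"] by simp
    moreover have "cos x = 1 - 2 * (sin (x / 2))\<^sup>2" using cos_double_sin[of "x / 2"] by simp
    ultimately show ?thesis by linarith
  qed
  have Re_ge: "norm (c i) * (1 - 2 * pi * \<epsilon>) \<le> Re (c i * exp (- (\<i> * of_real (l i * t))))" if "i < N" for i
  proof -
    \<comment> \<open>The phase of the rotated term, corrected by the whole turns \<open>m i\<close>
      so that it is small.\<close>
    define x where "x = Arg (c i) - l i * t + 2 * pi * of_int (m i)"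
    have "x = - (2 * pi) * (t * (l i / (2 * pi)) - of_int (m i) - Arg (c i) / (2 * pi))"
      by (simp add: x_def field_simps)
    then have "\<bar>x\<bar> = 2 * pi * \<bar>t * (l i / (2 * pi)) - of_int (m i) - Arg (c i) / (2 * pi)\<bar>"
      by (simp only: abs_mult) simp
    also have "\<dots> \<le> 2 * pi * \<epsilon>"
      using tm[OF that] by (intro mult_left_mono) auto
    finally have "1 - 2 * pi * \<epsilon> \<le> cos x" using cos_ge[of x] by linarith
    also have "cos x = cos (Arg (c i) - l i * t)"
      by (simp add: x_def cos_add)
    finally have "norm (c i) * (1 - 2 * pi * \<epsilon>) \<le> norm (c i) * cos (Arg (c i) - l i * t)"
      by (rule mult_left_mono) simp
    also have "\<dots> = Re (rcis (norm (c i)) (Arg (c i)) * cis (- (l i * t)))"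
      by (simp add: rcis_def cos_diff algebra_simps)
    also have "rcis (norm (c i)) (Arg (c i)) * cis (- (l i * t)) = c i * exp (- (\<i> * of_real (l i * t)))"
      by (simp add: rcis_cmod_Arg cis_conv_exp)
    finally show ?thesis .
  qed
  have "S * (1 - 2 * pi * \<epsilon>) \<le> Re (\<Sum>n<N. c n * exp (- (\<i> * of_real (l n * t))))"
    unfolding S_def sum_distrib_right Re_sum by (intro sum_mono Re_ge) auto
  also have "\<dots> \<le> C" using complex_Re_le_cmod bound by (rule order_trans)
  finally have "S \<le> C + S * (2 * pi * \<epsilon>)" by (simp add: algebra_simps)
  also have "S * (2 * pi * \<epsilon>) = e * (S / (S + 1))" using S by (simp add: \<epsilon>_def)
  also have "\<dots> \<le> e * 1" using S \<open>0 < e\<close> by (intro mult_left_mono) auto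
  finally show "(\<Sum>n<N. norm (c n)) \<le> C + e" by (simp add: S_def)
qed

lemma norm_partial_sum_rat_independent_le:
  assumes "frequency l" "rat_independent l" "a \<in> bounded_series l M" "0 < Re s"
  shows "norm (\<Sum>n<Suc k. dirichlet_term l a s n) \<le> M * kernel_const * (1 + ln 3)"
proof -
  have mono: "mono l" and nonneg: "0 \<le> l n" and inj: "inj l" for n
    using assms(1) by (auto simp: frequency_def strict_mono_mono strict_mono_imp_inj_on)
  define c where "c = l k + 1"
  have c: "1 \<le> c" using nonneg[of k] by (simp add: c_def)
  have "eventually (\<lambda>n. 2 * c + 1 \<le> l n) sequentially"
    using assms(1) by (auto simp: frequency_def filterlim_at_top)
  then obtain N0 where N0: "\<And>n. N0 \<le> n \<Longrightarrow> 2 * c + 1 \<le> l n"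
    by (auto simp: eventually_sequentially)
  define N where "N = max N0 (Suc k)"
  define A where "A = 2 * sin_cubic_mass * 1 * (2 * c - c)"
  have A: "0 < A" using c sin_cubic_mass_pos by (simp add: A_def)
  have "(\<Sum>n<N. norm (dirichlet_term l a s n * of_real (kernel_ft c (2 * c) 1 (l n - 0))))
     \<le> A * (M * kernel_const * (1 + ln ((2 * c + c) / (2 * c - c))))"
  proof (rule sum_norm_le_of_bounded_exponential_sum[OF assms(2) inj])
    fix t
    \<comment> \<open>Rotating the terms by t is a vertical shift of s, under which the bound on the
      smoothed sum persists.\<close>
    have eq: "dirichlet_term l a s n * of_real (kernel_ft c (2 * c) 1 (l n - 0)) * exp (- (\<i> * of_real (l n * t)))
        = dirichlet_term l a (s + \<i> * of_real t) n * of_real (kernel_ft c (2 * c) 1 (l n - 0))" for n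
      by (simp add: dirichlet_term_add mult_ac)
    show "norm (\<Sum>n<N. dirichlet_term l a s n * of_real (kernel_ft c (2 * c) 1 (l n - 0)) * exp (- (\<i> * of_real (l n * t))))
        \<le> A * (M * kernel_const * (1 + ln ((2 * c + c) / (2 * c - c))))"
      unfolding A_def eq
    proof (rule norm_smoothed_sum_le_ln[OF assms(1,3)])
      show "0 + 2 * c + 1 \<le> l n" if "N \<le> n" for n using N0[of n] that by (simp add: N_def)
    qed (use c assms(4) in auto)
  qed
  also have "(2 * c + c) / (2 * c - c) = 3" using c by simp
  finally have le: "(\<Sum>n<N. norm (dirichlet_term l a s n * of_real (kernel_ft c (2 * c) 1 (l n - 0))))
     \<le> A * (M * kernel_const * (1 + ln 3))" .
  have plateau: "kernel_ft c (2 * c) 1 (l n - 0) = A" if "n < Suc k" for n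
    unfolding A_def using c nonneg[of n] monoD[OF mono, of n k] that
    by (intro kernel_ft_plateau) (auto simp: c_def)
  have "A * norm (\<Sum>n<Suc k. dirichlet_term l a s n) \<le> A * (\<Sum>n<Suc k. norm (dirichlet_term l a s n))"
    using A by (intro mult_left_mono norm_sum) auto
  also have "\<dots> = (\<Sum>n<Suc k. norm (dirichlet_term l a s n * of_real (kernel_ft c (2 * c) 1 (l n - 0))))"
    unfolding sum_distrib_left using A by (intro sum.cong refl) (use plateau in \<open>simp add: norm_mult mult.commute[of A]\<close>)
  also have "\<dots> \<le> (\<Sum>n<N. norm (dirichlet_term l a s n * of_real (kernel_ft c (2 * c) 1 (l n - 0))))"
    by (intro sum_mono2) (auto simp: N_def)
  also note le
  finally show ?thesis using A by (simp only: mult_le_cancel_left_pos)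
qed

section \<open>Growth of partial sums under each hypothesis on the frequency\<close>

lemma freq_L_eq_0_imp:
  assumes "frequency l" "freq_L l = 0" "0 < \<delta>"
  shows "\<exists>B. \<forall>k. real (Suc k) \<le> B * exp (\<delta> * l k)"
proof -
  have "eventually (\<lambda>n. ereal (ln (real (Suc n)) / l n) < ereal \<delta>) sequentially"
    using assms(2,3) unfolding freq_L_def by (intro Limsup_lessD) simp
  moreover have "eventually (\<lambda>n. 0 < l n) sequentially"
    using assms(1) by (auto simp: frequency_def filterlim_at_top_dense)
  ultimately have "eventually (\<lambda>n. real (Suc n) \<le> exp (\<delta> * l n)) sequentially"
  proof eventually_elim
    case (elim n)
    then have "ln (real (Suc n)) \<le> \<delta> * l n" by (simp add: pos_divide_less_eq)
    then show ?case by (metis exp_ln exp_le_cancel_iff of_nat_0_less_iff zero_less_Suc)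
  qed
  then obtain n0 where n0: "\<And>n. n0 \<le> n \<Longrightarrow> real (Suc n) \<le> exp (\<delta> * l n)"
    by (auto simp: eventually_sequentially)
  \<comment> \<open>The finitely many indices below \<open>n0\<close> are absorbed by the constant,
    as l >= 0.\<close>
  have "real (Suc k) \<le> real (Suc n0) * exp (\<delta> * l k)" for k
  proof (cases "n0 \<le> k")
    case True
    have "1 * exp (\<delta> * l k) \<le> real (Suc n0) * exp (\<delta> * l k)" by (intro mult_right_mono) auto
    with n0[OF True] show ?thesis by linarith
  next
    case False
    have "real (Suc n0) * 1 \<le> real (Suc n0) * exp (\<delta> * l k)"
      using assms by (intro mult_left_mono) (auto simp: frequency_def)
    moreover have "real (Suc k) \<le> real (Suc n0)" using False by simp
    ultimately show ?thesis by (metis mult.right_neutral order_trans)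
  qed
  then show ?thesis by blast
qed

text \<open>The gap enters the partial sum bound through - ln g, and the logarithm undoes one of the
  two exponentials in Landau's condition.\<close>

lemma landau_condition_imp:
  assumes "frequency l" "landau_condition l" "0 < \<delta>"
  shows "\<exists>B. \<forall>k. \<exists>g. 0 < g \<and> g \<le> l (Suc k) - l k \<and> 1 + ln ((6 * l k + 3 * g) / g) \<le> B * exp (\<delta> * l k)"
proof -
  obtain C where C: "0 < C" "\<And>n. C * exp (- exp (\<delta> * l n)) \<le> l (Suc n) - l n"
    using assms(2,3) unfolding landau_condition_def by blast
  have "\<exists>g. 0 < g \<and> g \<le> l (Suc k) - l k \<and>
      1 + ln ((6 * l k + 3 * g) / g) \<le> (4 + \<bar>ln C\<bar> + 6 / \<delta>) * exp (\<delta> * l k)" for k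
  proof (intro exI conjI)
    \<comment> \<open>The cap at 1 keeps ln (6 l k + 3 g) below 6 l k + 2; using less than the full
      gap is allowed. In the constant, 4 is 3 from these terms plus 1 from the exponential in - ln
      g.\<close>
    define g where "g = min 1 (C * exp (- exp (\<delta> * l k)))"
    show g: "0 < g" using C(1) by (simp add: g_def)
    show "g \<le> l (Suc k) - l k" using C(2)[of k] by (simp add: g_def)
    have nonneg: "0 \<le> l k" using assms(1) by (simp add: frequency_def)
    have exp_ge: "1 \<le> exp (\<delta> * l k)" using nonneg assms(3) by simp
    have "ln ((6 * l k + 3 * g) / g) = ln (6 * l k + 3 * g) - ln g"
      using g nonneg by (simp add: ln_div)
    moreover have "ln (6 * l k + 3 * g) \<le> (6 * l k + 3 * g) - 1"
      using g nonneg by (intro ln_le_minus_one) auto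
    moreover have "g \<le> 1" by (simp add: g_def)
    moreover have "- ln g \<le> \<bar>ln C\<bar> + exp (\<delta> * l k)"
    proof (cases "C * exp (- exp (\<delta> * l k)) \<le> 1")
      case True
      then have "ln g = ln C - exp (\<delta> * l k)" using C(1) by (simp add: g_def ln_mult)
      then show ?thesis by linarith
    qed (simp add: g_def)
    ultimately have "1 + ln ((6 * l k + 3 * g) / g) \<le> 3 + 6 * l k + \<bar>ln C\<bar> + exp (\<delta> * l k)"
      by linarith
    moreover have "6 * l k \<le> 6 / \<delta> * exp (\<delta> * l k)"
    proof -
      have "\<delta> * l k \<le> exp (\<delta> * l k)"
        using exp_ge_add_one_self[of "\<delta> * l k"] by linarith
      then have "6 / \<delta> * (\<delta> * l k) \<le> 6 / \<delta> * exp (\<delta> * l k)"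
        using assms(3) by (intro mult_left_mono) auto
      then show ?thesis using assms(3) by simp
    qed
    moreover have "(4 + \<bar>ln C\<bar> + 6 / \<delta>) * exp (\<delta> * l k)
        = 4 * exp (\<delta> * l k) + \<bar>ln C\<bar> * exp (\<delta> * l k) + 6 / \<delta> * exp (\<delta> * l k)"
      by (simp only: distrib_right)
    ultimately show "1 + ln ((6 * l k + 3 * g) / g) \<le> (4 + \<bar>ln C\<bar> + 6 / \<delta>) * exp (\<delta> * l k)"
      using exp_ge mult_left_mono[OF exp_ge abs_ge_zero, of "ln C"] by linarith
  qed
  then show ?thesis by blast
qed

text \<open>What matters is the order of quantifiers: B is chosen before the series, s and k, so one
  tail estimate serves the whole family.\<close>

proposition norm_partial_sum_growth:
  assumes "frequency l" "landau_condition l \<or> freq_L l = 0 \<or> rat_independent l" "0 < \<delta>"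
  obtains B where "\<And>a s k. a \<in> bounded_series l M \<Longrightarrow> 0 < Re s \<Longrightarrow>
    norm (\<Sum>n<Suc k. dirichlet_term l a s n) \<le> B * exp (\<delta> * l k)"
proof -
  consider "landau_condition l" | "freq_L l = 0" | "rat_independent l" using assms(2) by blast
  then show ?thesis
  proof cases
    case 1
    then obtain B where B: "\<And>k. \<exists>g. 0 < g \<and> g \<le> l (Suc k) - l k \<and> 1 + ln ((6 * l k + 3 * g) / g) \<le> B * exp (\<delta> * l k)"
      using landau_condition_imp assms(1,3) by blast
    have "norm (\<Sum>n<Suc k. dirichlet_term l a s n) \<le> (M * kernel_const * B) * exp (\<delta> * l k)"
      if a: "a \<in> bounded_series l M" and s: "0 < Re s" for a s k
    proof -
      obtain g where g: "0 < g" "g \<le> l (Suc k) - l k" "1 + ln ((6 * l k + 3 * g) / g) \<le> B * exp (\<delta> * l k)"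
        using B by blast
      have "norm (\<Sum>n<Suc k. dirichlet_term l a s n) \<le> M * kernel_const * (1 + ln ((6 * l k + 3 * g) / g))"
        by (rule norm_partial_sum_gap_le[OF assms(1) a g(1,2) s])
      also have "\<dots> \<le> M * kernel_const * (B * exp (\<delta> * l k))"
        using g(3) bounded_series_nonneg[OF a] kernel_const_pos by (intro mult_left_mono) auto
      finally show ?thesis by (simp add: mult.assoc)
    qed
    then show ?thesis by (rule that)
  next
    case 2
    then obtain B where B: "\<And>k. real (Suc k) \<le> B * exp (\<delta> * l k)"
      using freq_L_eq_0_imp assms(1,3) by blast
    have "norm (\<Sum>n<Suc k. dirichlet_term l a s n) \<le> (M * kernel_const * (1 + ln 3) * B) * exp (\<delta> * l k)"
      if a: "a \<in> bounded_series l M" and s: "0 < Re s" for a s k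
    proof -
      have "norm (\<Sum>n<Suc k. dirichlet_term l a s n) \<le> (\<Sum>n<Suc k. M * kernel_const * (1 + ln 3))"
        by (intro sum_norm_le norm_dirichlet_term_le assms a s)
      also have "\<dots> = M * kernel_const * (1 + ln 3) * real (Suc k)" by simp
      also have "\<dots> \<le> M * kernel_const * (1 + ln 3) * (B * exp (\<delta> * l k))"
        using B bounded_series_nonneg[OF a] kernel_const_pos by (intro mult_left_mono) auto
      finally show ?thesis by (simp add: mult.assoc)
    qed
    then show ?thesis by (rule that)
  next
    case 3
    have "norm (\<Sum>n<Suc k. dirichlet_term l a s n) \<le> (M * kernel_const * (1 + ln 3)) * exp (\<delta> * l k)"
      if a: "a \<in> bounded_series l M" and s: "0 < Re s" for a s k
    proof -
      have "norm (\<Sum>n<Suc k. dirichlet_term l a s n) \<le> M * kernel_const * (1 + ln 3) * 1"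
        using norm_partial_sum_rat_independent_le[OF assms(1) 3 a s, of k] by simp
      also have "\<dots> \<le> M * kernel_const * (1 + ln 3) * exp (\<delta> * l k)"
        using bounded_series_nonneg[OF a] kernel_const_pos assms(1,3)
        by (intro mult_left_mono) (auto simp: frequency_def)
      finally show ?thesis .
    qed
    then show ?thesis by (rule that)
  qed
qed

section \<open>Uniform convergence and compactness\<close>

text \<open>The point s - 2 \<delta> still lies in the right half-plane, so the growth bound holds
  there, and moving back to s supplies the weights exp (- 2 \<delta> l n). Blocks are differences of
  two partial sums, which gives 2 B and finally 4 B.\<close>

lemma norm_sum_dirichlet_term_tail_le:
  assumes "frequency l" "0 < \<delta>" "0 \<le> B" "2 * \<delta> < Re s" "m \<le> k"
    and growth: "\<And>s k. 0 < Re s \<Longrightarrow> norm (\<Sum>n<Suc k. dirichlet_term l a s n) \<le> B * exp (\<delta> * l k)"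
  shows "norm (\<Sum>n=m..<k. dirichlet_term l a s n) \<le> 4 * B * exp (- (\<delta> * l m))"
proof -
  define s' where "s' = s - of_real (2 * \<delta>)"
  have mono: "mono l" and s': "0 < Re s'" and nonneg: "0 \<le> l n" for n
    using assms by (auto simp: frequency_def strict_mono_mono s'_def)
  have "norm (\<Sum>n=m..<k. dirichlet_term l a s' n * of_real (exp (- (2 * \<delta> * l n)))) \<le> 2 * (2 * B) * exp (- (\<delta> * l m))"
  proof (rule norm_sum_exp_tail_le[OF mono assms(2,5)])
    fix k assume "m \<le> k"
    have "norm (\<Sum>n<m. dirichlet_term l a s' n) \<le> B * exp (\<delta> * l k)"
    proof (cases m)
      case 0
      then show ?thesis using assms(3) by simp
    next
      case (Suc j)
      have "norm (\<Sum>n<m. dirichlet_term l a s' n) \<le> B * exp (\<delta> * l j)"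
        unfolding Suc by (rule growth[OF s'])
      also have "\<dots> \<le> B * exp (\<delta> * l k)"
        using assms(2,3) monoD[OF mono, of j k] \<open>m \<le> k\<close> Suc by (intro mult_left_mono) auto
      finally show ?thesis .
    qed
    moreover have "(\<Sum>n=m..<Suc k. dirichlet_term l a s' n) = (\<Sum>n<Suc k. dirichlet_term l a s' n) - (\<Sum>n<m. dirichlet_term l a s' n)"
      using \<open>m \<le> k\<close> sum_diff_nat_ivl[of 0 m "Suc k" "dirichlet_term l a s'"] by (simp add: atLeast0LessThan)
    ultimately show "norm (\<Sum>n=m..<Suc k. dirichlet_term l a s' n) \<le> 2 * B * exp (\<delta> * l k)"
      using growth[OF s', of k] norm_triangle_ineq4[of "\<Sum>n<Suc k. dirichlet_term l a s' n" "\<Sum>n<m. dirichlet_term l a s' n"]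
      by (simp only:)
  qed (use assms(3) in simp)
  moreover have "dirichlet_term l a s' n * of_real (exp (- (2 * \<delta> * l n))) = dirichlet_term l a s n" for n
    using dirichlet_term_add[of l a s' "of_real (2 * \<delta>)" n]
    by (simp add: s'_def mult.commute flip: exp_of_real)
  ultimately show ?thesis by simp
qed

lemma ex_exp_frequency_less:
  assumes "frequency l" "0 < \<delta>" "0 < e"
  shows "\<exists>m. B * exp (- (\<delta> * l m)) < e"
proof -
  have "filterlim l at_top sequentially" using assms(1) by (simp add: frequency_def)
  then have "(\<lambda>m. B * exp (- (\<delta> * l m))) \<longlonglongrightarrow> B * 0"
    using assms(2)
    by (intro tendsto_mult tendsto_const filterlim_compose[OF exp_at_bot]
        filterlim_compose[OF filterlim_uminus_at_bot_at_top] filterlim_tendsto_pos_mult_at_top) auto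
  then have "eventually (\<lambda>m. B * exp (- (\<delta> * l m)) < e) sequentially"
    using assms(3) by (auto dest: order_tendstoD)
  then show ?thesis by (auto simp: eventually_sequentially)
qed

text \<open>Meant for the limit series, whose convergence has to be deduced from the growth bound
  alone.\<close>

lemma summable_dirichlet_term:
  assumes "frequency l" "0 < Re s"
    and growth: "\<And>\<delta>. 0 < \<delta> \<Longrightarrow> \<exists>B\<ge>0. \<forall>s k. 0 < Re s \<longrightarrow> norm (\<Sum>n<Suc k. dirichlet_term l a s n) \<le> B * exp (\<delta> * l k)"
  shows "summable (dirichlet_term l a s)"
  unfolding summable_Cauchy
proof (intro allI impI)
  fix e :: real assume "0 < e"
  define \<delta> where "\<delta> = Re s / 3"
  have \<delta>: "0 < \<delta>" "2 * \<delta> < Re s" using assms(2) by (auto simp: \<delta>_def)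
  obtain B where B: "0 \<le> B" "\<And>s k. 0 < Re s \<Longrightarrow> norm (\<Sum>n<Suc k. dirichlet_term l a s n) \<le> B * exp (\<delta> * l k)"
    using growth[OF \<delta>(1)] by blast
  obtain m where m: "4 * B * exp (- (\<delta> * l m)) < e"
    using ex_exp_frequency_less[OF assms(1) \<delta>(1) \<open>0 < e\<close>] by blast
  have "norm (sum (dirichlet_term l a s) {i..<j}) < e" if "m \<le> i" for i j
  proof (cases "i \<le> j")
    case True
    have "norm (sum (dirichlet_term l a s) {i..<j}) \<le> 4 * B * exp (- (\<delta> * l i))"
      by (rule norm_sum_dirichlet_term_tail_le[OF assms(1) \<delta>(1) B(1) \<delta>(2) True B(2)])
    also have "\<dots> \<le> 4 * B * exp (- (\<delta> * l m))"
      using B(1) \<delta>(1) assms(1) that by (intro mult_left_mono) (auto simp: frequency_def strict_mono_less_eq)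
    also note m
    finally show ?thesis .
  qed (use \<open>0 < e\<close> in simp)
  then show "\<exists>N. \<forall>m\<ge>N. \<forall>n. norm (sum (dirichlet_term l a s) {m..<n}) < e" by blast
qed

lemma norm_dirichlet_sum_diff_le:
  assumes "frequency l" "0 < \<delta>" "0 \<le> B" "2 * \<delta> < Re s" "summable (dirichlet_term l a s)"
    and growth: "\<And>s k. 0 < Re s \<Longrightarrow> norm (\<Sum>n<Suc k. dirichlet_term l a s n) \<le> B * exp (\<delta> * l k)"
  shows "norm (dirichlet_sum l a s - (\<Sum>n<m. dirichlet_term l a s n)) \<le> 4 * B * exp (- (\<delta> * l m))"
proof (rule LIMSEQ_le_const2)
  show "(\<lambda>k. norm ((\<Sum>n<k. dirichlet_term l a s n) - (\<Sum>n<m. dirichlet_term l a s n)))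
      \<longlonglongrightarrow> norm (dirichlet_sum l a s - (\<Sum>n<m. dirichlet_term l a s n))"
    using summable_sums[OF assms(5)]
    by (intro tendsto_norm tendsto_diff tendsto_const) (simp add: sums_def dirichlet_sum_def)
  show "\<exists>N. \<forall>k\<ge>N. norm ((\<Sum>n<k. dirichlet_term l a s n) - (\<Sum>n<m. dirichlet_term l a s n)) \<le> 4 * B * exp (- (\<delta> * l m))"
  proof (intro exI allI impI)
    fix k assume "m \<le> k"
    then have "(\<Sum>n<k. dirichlet_term l a s n) - (\<Sum>n<m. dirichlet_term l a s n) = (\<Sum>n=m..<k. dirichlet_term l a s n)"
      using sum_diff_nat_ivl[of 0 m k "dirichlet_term l a s"] by (simp add: atLeast0LessThan)
    then show "norm ((\<Sum>n<k. dirichlet_term l a s n) - (\<Sum>n<m. dirichlet_term l a s n)) \<le> 4 * B * exp (- (\<delta> * l m))"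
      using norm_sum_dirichlet_term_tail_le[OF assms(1-4) \<open>m \<le> k\<close> growth] by simp
  qed
qed

section \<open>Extraction of a convergent subsequence\<close>

lemma mem_bounded_series:
  assumes "a \<in> D_infty l" "norm_infty l a \<le> M"
  shows "a \<in> bounded_series l M"
proof -
  have "norm (dirichlet_sum l a s) \<le> norm_infty l a" if "0 < Re s" for s
    unfolding norm_infty_def
  proof (rule cSUP_upper)
    \<comment> \<open>Boundedness makes the real supremum a genuine upper bound.\<close>
    have "bounded (dirichlet_sum l a ` {s. 0 < Re s})" using assms(1) by (simp add: D_infty_def)
    then show "bdd_above ((\<lambda>s. norm (dirichlet_sum l a s)) ` {s. 0 < Re s})"
      by (auto simp: bounded_iff bdd_above_def)
  qed (use that in simp)
  with assms show ?thesis by (force simp: bounded_series_def)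
qed

theorem theorem4p10:
  fixes l :: "nat \<Rightarrow> real" and a :: "nat \<Rightarrow> nat \<Rightarrow> complex"
  assumes "frequency l"
    and "landau_condition l \<or> freq_L l = 0 \<or> rat_independent l"
    and "\<And>j. a j \<in> D_infty l"
    and "bdd_above (range (\<lambda>j. norm_infty l (a j)))"
  shows "\<exists>r b. strict_mono (r :: nat \<Rightarrow> nat) \<and>
           (\<forall>n. (\<lambda>k. a (r k) n) \<longlonglongrightarrow> b n) \<and>
           b \<in> D_infty l \<and>
           (\<forall>\<epsilon>>0. uniform_limit {s. Re s > \<epsilon>}
              (\<lambda>k. dirichlet_sum l (a (r k))) (dirichlet_sum l b) sequentially)"
proof -
  obtain M where M: "\<And>j. norm_infty l (a j) \<le> M"
    using assms(4) by (auto simp: bdd_above_def)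
  have a: "a j \<in> bounded_series l M" for j
    using assms(3) M by (rule mem_bounded_series)
  \<comment> \<open>The term bound at s = 1 controls a_n exp (- l n) by one constant for all n and
    j, as the diagonal argument asks; the positive weight is divided out afterwards.\<close>
  define R where "R n = norm (exp (- complex_of_real (l n)))" for n
  have R: "0 < R n" for n by (simp add: R_def)
  have coeff: "norm (a j n * of_real (R n)) \<le> M * kernel_const * (1 + ln 3)" for j n
    using norm_dirichlet_term_le[OF assms(1) a, of 1 j n] R[of n]
    by (simp add: dirichlet_term_def norm_mult R_def)
  obtain r where r: "strict_mono (r :: nat \<Rightarrow> nat)" "\<And>n. n \<in> UNIV \<Longrightarrow> \<exists>x. (\<lambda>k. a (r k) n * of_real (R n)) \<longlonglongrightarrow> x"
    using function_convergent_subsequence[of "UNIV :: nat set" "\<lambda>j n. a j n * of_real (R n)", OF _ coeff] by auto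
  have "\<exists>x. (\<lambda>k. a (r k) n) \<longlonglongrightarrow> x" for n
  proof -
    obtain x where "(\<lambda>k. a (r k) n * of_real (R n)) \<longlonglongrightarrow> x" using r(2) by auto
    from tendsto_divide[OF this tendsto_const[of "complex_of_real (R n)"]]
    have "(\<lambda>k. a (r k) n) \<longlonglongrightarrow> x / of_real (R n)" using R[of n] by simp
    then show ?thesis by blast
  qed
  then obtain b where b: "\<And>n. (\<lambda>k. a (r k) n) \<longlonglongrightarrow> b n" by metis
  have partial_tendsto: "(\<lambda>k. \<Sum>n<m. dirichlet_term l (a (r k)) s n) \<longlonglongrightarrow> (\<Sum>n<m. dirichlet_term l b s n)" for m s
    unfolding dirichlet_term_def by (intro tendsto_sum tendsto_mult b tendsto_const)
  \<comment> \<open>Each bound concerns a finite sum, hence passes to the coefficientwise limit b,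
    which then shares its tail estimate with every \<open>a j\<close>.\<close>
  have growth: "\<exists>B\<ge>0. \<forall>c\<in>insert b (range a). \<forall>s k. 0 < Re s \<longrightarrow> norm (\<Sum>n<Suc k. dirichlet_term l c s n) \<le> B * exp (\<delta> * l k)"
    if \<delta>: "0 < \<delta>" for \<delta>
  proof -
    obtain B0 where "\<And>a s k. a \<in> bounded_series l M \<Longrightarrow> 0 < Re s \<Longrightarrow> norm (\<Sum>n<Suc k. dirichlet_term l a s n) \<le> B0 * exp (\<delta> * l k)"
      using norm_partial_sum_growth[OF assms(1,2) \<delta>] by blast
    then have B0: "norm (\<Sum>n<Suc k. dirichlet_term l (a j) s n) \<le> B0 * exp (\<delta> * l k)" if "0 < Re s" for j s k
      using a that by blast
    have "0 \<le> B0 * exp (\<delta> * l 0)" by (rule order_trans[OF norm_ge_zero B0[of 1]]) simp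
    then have "0 \<le> B0" by (simp add: zero_le_mult_iff)
    moreover have "norm (\<Sum>n<Suc k. dirichlet_term l b s n) \<le> B0 * exp (\<delta> * l k)" if "0 < Re s" for s k
      by (rule LIMSEQ_le_const2[OF tendsto_norm[OF partial_tendsto]]) (use B0 that in blast)
    ultimately show ?thesis using B0 by auto
  qed
  have summable_b: "summable (dirichlet_term l b s)" if "0 < Re s" for s
  proof (rule summable_dirichlet_term[OF assms(1) that])
    fix \<delta> :: real assume "0 < \<delta>"
    from growth[OF this] show "\<exists>B\<ge>0. \<forall>s k. 0 < Re s \<longrightarrow> norm (\<Sum>n<Suc k. dirichlet_term l b s n) \<le> B * exp (\<delta> * l k)"
      by simp blast
  qed
  have summable_a: "summable (dirichlet_term l (a j) s)" if "0 < Re s" for j s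
    using assms(3) that by (simp add: D_infty_def)
  have unif: "uniform_limit {s. Re s > \<epsilon>} (\<lambda>k. dirichlet_sum l (a (r k))) (dirichlet_sum l b) sequentially"
    if \<epsilon>: "0 < \<epsilon>" for \<epsilon>
    unfolding uniform_limit_sequentially_iff
  proof (intro allI impI)
    fix e :: real assume e: "0 < e"
    \<comment> \<open>So that 2 \<delta> = \<epsilon> < Re s, as the tail estimate requires.\<close>
    define \<delta> where "\<delta> = \<epsilon> / 2"
    have \<delta>: "0 < \<delta>" using \<epsilon> by (simp add: \<delta>_def)
    obtain B where B: "0 \<le> B" "\<And>c s k. c \<in> insert b (range a) \<Longrightarrow> 0 < Re s \<Longrightarrow>
        norm (\<Sum>n<Suc k. dirichlet_term l c s n) \<le> B * exp (\<delta> * l k)"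
      using growth[OF \<delta>] by blast
    obtain m where m: "4 * B * exp (- (\<delta> * l m)) < e / 3"
      using ex_exp_frequency_less[OF assms(1) \<delta>, of "e / 3" "4 * B"] e by auto
    have tail: "norm (dirichlet_sum l c s - (\<Sum>n<m. dirichlet_term l c s n)) < e / 3"
      if "c \<in> insert b (range a)" "\<epsilon> < Re s" for c s
    proof -
      have s: "2 * \<delta> < Re s" "0 < Re s" using that(2) \<epsilon> by (auto simp: \<delta>_def)
      have "norm (dirichlet_sum l c s - (\<Sum>n<m. dirichlet_term l c s n)) \<le> 4 * B * exp (- (\<delta> * l m))"
        using that(1) summable_a summable_b s
        by (intro norm_dirichlet_sum_diff_le[OF assms(1) \<delta> B(1) s(1) _ B(2)]) auto
      with m show ?thesis by linarith
    qed
    have lim: "(\<lambda>k. \<Sum>n<m. norm (a (r k) n - b n)) \<longlonglongrightarrow> (\<Sum>n<m. norm (b n - b n))"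
      by (intro tendsto_sum tendsto_norm tendsto_diff b tendsto_const)
    have "eventually (\<lambda>k. (\<Sum>n<m. norm (a (r k) n - b n)) < e / 3) sequentially"
      by (rule order_tendstoD(2)[OF lim]) (use e in simp)
    then obtain k0 where k0: "\<And>k. k0 \<le> k \<Longrightarrow> (\<Sum>n<m. norm (a (r k) n - b n)) < e / 3"
      by (auto simp: eventually_sequentially)
    show "\<exists>N. \<forall>k\<ge>N. \<forall>s\<in>{s. \<epsilon> < Re s}. dist (dirichlet_sum l (a (r k)) s) (dirichlet_sum l b s) < e"
    proof (intro exI allI impI ballI)
      fix k s assume k: "k0 \<le> k" and "s \<in> {s. \<epsilon> < Re s}"
      then have s: "\<epsilon> < Re s" by simp
      \<comment> \<open>For Re s > 0 the exponentials have modulus at most 1, so coefficient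
        differences control the first m terms uniformly in s.\<close>
      have "norm ((\<Sum>n<m. dirichlet_term l (a (r k)) s n) - (\<Sum>n<m. dirichlet_term l b s n))
          \<le> (\<Sum>n<m. norm (a (r k) n - b n))"
        unfolding sum_subtractf[symmetric]
      proof (rule sum_norm_le)
        fix n
        have "norm (dirichlet_term l (a (r k)) s n - dirichlet_term l b s n)
            = norm (a (r k) n - b n) * exp (- (l n * Re s))"
          by (simp add: dirichlet_term_def norm_mult flip: left_diff_distrib)
        also have "\<dots> \<le> norm (a (r k) n - b n) * 1"
          using assms(1) s \<epsilon> by (intro mult_left_mono) (auto simp: frequency_def)
        finally show "norm (dirichlet_term l (a (r k)) s n - dirichlet_term l b s n) \<le> norm (a (r k) n - b n)"
          by simp
      qed
      with k0[OF k] have "norm ((\<Sum>n<m. dirichlet_term l (a (r k)) s n) - (\<Sum>n<m. dirichlet_term l b s n)) < e / 3"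
        by linarith
      moreover have "norm (dirichlet_sum l (a (r k)) s - (\<Sum>n<m. dirichlet_term l (a (r k)) s n)) < e / 3"
        "norm (dirichlet_sum l b s - (\<Sum>n<m. dirichlet_term l b s n)) < e / 3"
        using tail s by auto
      ultimately show "dist (dirichlet_sum l (a (r k)) s) (dirichlet_sum l b s) < e"
        unfolding dist_norm[symmetric] dist_commute[of "dirichlet_sum l b s"]
        by (blast intro: dist_triangle_third)
    qed
  qed
  \<comment> \<open>Uniform convergence on smaller half-planes alone gives no bound up to the
    imaginary axis; the bound M, common to the sequence, passes to the pointwise limit.\<close>
  have "norm (dirichlet_sum l b s) \<le> M" if "0 < Re s" for s
  proof (rule LIMSEQ_le_const2)
    show "(\<lambda>k. norm (dirichlet_sum l (a (r k)) s)) \<longlonglongrightarrow> norm (dirichlet_sum l b s)"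
      using tendsto_uniform_limitI[OF unif[of "Re s / 2"], of s] that by (intro tendsto_norm) auto
    show "\<exists>N. \<forall>k\<ge>N. norm (dirichlet_sum l (a (r k)) s) \<le> M"
      using a that by (auto simp: bounded_series_def)
  qed
  then have "b \<in> D_infty l"
    using summable_b by (auto simp: D_infty_def bounded_iff)
  with r(1) b unif show ?thesis by blast
qed

end
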